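(* Let $k \geq 2$ be an integer and let $G$ be an outerplanar graph with $n = 5k+1$ vertices. Then $G$ has a secure dominating set of size $\frac{n+4}{5} = k+1$ if and only if $G$ contains a spanning subgraph isomorphic to the graph $G_{k}$ defined as follows: \[ V(G_{k}) = \{v, v_{1}, \dots, v_{k}\} \cup \{w_{1}, \dots, w_{2k}\} \cup \{u_{i}^{1}, u_{i}^{2} \mid i = 1,\dots,k\}, \] \[ E(G_{k}) = \{v w_{i} \mid 1 \le i \le 2k\} \cup \{v_{i} w_{2i-1}, v_{i} w_{2i} \mid 1 \le i \le k\} \cup \{v_{i}u_{i}^{1}, v_{i}u_{i}^{2}, u_{i}^{1}u_{i}^{2} \mid 1 \le i \le k\}. \]
   Context: All graphs are finite, simple and undirected. A graph is outerplanar if it has a crossing-free embedding in the plane such that all vertices lie on the boundary of the outer (unbounded) face. A set $S \subseteq V(G)$ is a dominating set if every vertex not in $S$ is adjacent to some vertex of $S$. A dominating set $S$ is a secure dominating set if for every vertex $u \in V(G)\setminus S$ there exists a vertex $v \in S$ with $uv \in E(G)$ such that $(S \setminus \{v\}) \cup \{u\}$ is also a dominating set of $G$. A spanning subgraph of $G$ is a subgraph containing all vertices of $G$. *)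

theory Defs
  imports "HOL-Analysis.Analysis"
begin

section \<open>Finite simple undirected graphs\<close>

type_synonym 'a graph = "'a set \<times> 'a set set"

abbreviation verts :: "'a graph \<Rightarrow> 'a set" where
  "verts G \<equiv> fst G"

abbreviation edges :: "'a graph \<Rightarrow> 'a set set" where
  "edges G \<equiv> snd G"

definition simple_graph :: "'a graph \<Rightarrow> bool" where
  "simple_graph G \<longleftrightarrow> finite (verts G) \<and> (\<forall>e\<in>edges G. e \<subseteq> verts G \<and> card e = 2)"

definition adjacent :: "'a graph \<Rightarrow> 'a \<Rightarrow> 'a \<Rightarrow> bool" where
  "adjacent G u v \<longleftrightarrow> {u, v} \<in> edges G"

definition spanning_subgraph :: "'a graph \<Rightarrow> 'a graph \<Rightarrow> bool" where
  "spanning_subgraph H G \<longleftrightarrow>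
     simple_graph H \<and> verts H = verts G \<and> edges H \<subseteq> edges G"

definition isomorphic :: "'a graph \<Rightarrow> 'b graph \<Rightarrow> bool" where
  "isomorphic G H \<longleftrightarrow>
     (\<exists>f. bij_betw f (verts G) (verts H) \<and>
          (\<forall>u\<in>verts G. \<forall>v\<in>verts G. adjacent G u v \<longleftrightarrow> adjacent H (f u) (f v)))"


section \<open>Outerplanarity\<close>

text \<open>
  The plane is the type of complex numbers. A crossing-free embedding places the vertices at
  distinct points \<open>p v\<close> and draws each edge \<open>e\<close> as a simple arc \<open>g e\<close> joining the two points of
  \<open>p ` e\<close>, so that arcs contain no other vertex points and meet only in common end vertices.
\<close>

definition plane_embedding ::
  "'a graph \<Rightarrow> ('a \<Rightarrow> complex) \<Rightarrow> ('a set \<Rightarrow> real \<Rightarrow> complex) \<Rightarrow> bool" where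
  "plane_embedding G p g \<longleftrightarrow>
     inj_on p (verts G) \<and>
     (\<forall>e\<in>edges G. arc (g e) \<and> {pathstart (g e), pathfinish (g e)} = p ` e \<and>
                  path_image (g e) \<inter> p ` verts G = p ` e) \<and>
     (\<forall>e\<in>edges G. \<forall>e'\<in>edges G. e \<noteq> e' \<longrightarrow>
        path_image (g e) \<inter> path_image (g e') \<subseteq> p ` (e \<inter> e'))"

definition drawing ::
  "'a graph \<Rightarrow> ('a \<Rightarrow> complex) \<Rightarrow> ('a set \<Rightarrow> real \<Rightarrow> complex) \<Rightarrow> complex set" where
  "drawing G p g = p ` verts G \<union> (\<Union>e\<in>edges G. path_image (g e))"

text \<open>
  For finite \<open>G\<close> the drawing is compact, so \<^const>\<open>outside\<close>, the union of the unbounded components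
  of the complement, is the single unbounded face.
\<close>

definition outerplanar :: "'a graph \<Rightarrow> bool" where
  "outerplanar G \<longleftrightarrow>
     (\<exists>p g. plane_embedding G p g \<and> p ` verts G \<subseteq> frontier (outside (drawing G p g)))"


section \<open>Secure domination\<close>

definition dominating_set :: "'a graph \<Rightarrow> 'a set \<Rightarrow> bool" where
  "dominating_set G S \<longleftrightarrow>
     S \<subseteq> verts G \<and> (\<forall>u\<in>verts G - S. \<exists>v\<in>S. adjacent G u v)"

definition secure_dominating_set :: "'a graph \<Rightarrow> 'a set \<Rightarrow> bool" where
  "secure_dominating_set G S \<longleftrightarrow>
     dominating_set G S \<and>
     (\<forall>u\<in>verts G - S. \<exists>v\<in>S. adjacent G u v \<and> dominating_set G ((S - {v}) \<union> {u}))"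


section \<open>The graphs \<open>G\<^sub>k\<close>\<close>

text \<open>\<open>Uv i j\<close> stands for \<open>u\<^sub>i\<^sup>j\<close>, with \<open>j\<close> ranging over \<open>{1, 2}\<close>.\<close>

datatype gk_vertex = Center | Vv nat | Wv nat | Uv nat nat

definition Gk :: "nat \<Rightarrow> gk_vertex graph" where
  "Gk k =
    ({Center} \<union> Vv ` {1..k} \<union> Wv ` {1..2*k} \<union> {Uv i j | i j. i \<in> {1..k} \<and> j \<in> {1, 2}},
     {{Center, Wv i} | i. i \<in> {1..2*k}} \<union>
     {{Vv i, Wv (2*i - 1)} | i. i \<in> {1..k}} \<union>
     {{Vv i, Wv (2*i)} | i. i \<in> {1..k}} \<union>
     {{Vv i, Uv i 1} | i. i \<in> {1..k}} \<union>
     {{Vv i, Uv i 2} | i. i \<in> {1..k}} \<union>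
     {{Uv i 1, Uv i 2} | i. i \<in> {1..k}})"

lemma finite_verts_Gk: "finite (verts (Gk k))"
proof -
  have "{Uv i j | i j. i \<in> {1..k} \<and> j \<in> {1, 2}} = (\<lambda>(i, j). Uv i j) ` ({1..k} \<times> {1, 2})"
    by force
  then show ?thesis
    by (simp add: Gk_def)
qed

lemma simple_graph_Gk: "simple_graph (Gk k)"
proof -
  have "Wv (2 * i - Suc 0) \<in> Wv ` {Suc 0..2 * k}" if "Suc 0 \<le> i" "i \<le> k" for i
    using that by (intro imageI) auto
  then show ?thesis
    using finite_verts_Gk[of k] unfolding simple_graph_def
    by (auto simp: Gk_def card_insert_if)
qed

end

theory Submission
  imports Defs "HOL-Complex_Analysis.Winding_Numbers"
begin

text \<open>
  An outerplanar graph contains neither \<open>K\<^sub>4\<close> nor a theta graph, that is, three internally disjoint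
  paths between two vertices, each with an inner vertex: one of the paths would run inside the closed
  curve formed by the other two. Let \<open>S\<close> be a secure dominating set and \<open>Q\<close> the set of vertices
  outside \<open>S\<close> with at least two neighbours in \<open>S\<close>. Regarding each \<open>q \<in> Q\<close> as an edge between
  two of these neighbours gives a multigraph on \<open>S\<close> without theta graphs, whence
  \<open>|Q| \<le> 2 (|S| - 1)\<close>. The private neighbours of \<open>v \<in> S\<close> form a clique together with \<open>v\<close>, so
  there are at most two of them, and at most one if \<open>v\<close> defends a vertex of \<open>Q\<close>. If
  \<open>|S| = k + 1\<close> and \<open>n = 5 k + 1\<close>, these bounds are so tight that all vertices of \<open>Q\<close> are defended
  by a single \<open>v \<in> S\<close> without private neighbours, while each other \<open>s \<in> S\<close> has two private neighbours
  and two common neighbours with \<open>v\<close> in \<open>Q\<close>; this is \<open>G\<^sub>k\<close>.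
\<close>

section \<open>Theta curves and plane walks\<close>

lemma closure_inside_arcs:
  fixes c d :: "real \<Rightarrow> complex"
  assumes "arc c" "pathstart c = a" "pathfinish c = b"
    and "arc d" "pathstart d = a" "pathfinish d = b"
    and "path_image c \<inter> path_image d = {a, b}"
  shows "closure (inside (path_image c \<union> path_image d)) =
           inside (path_image c \<union> path_image d) \<union> path_image c \<union> path_image d"
    and "connected (inside (path_image c \<union> path_image d))"
    and "open (inside (path_image c \<union> path_image d))"
    and "inside (path_image c \<union> path_image d) \<noteq> {}"
proof -
  \<comment> \<open>Running back along \<open>d\<close> closes \<open>c\<close> to a simple closed
    path, to which the Jordan curve theorem applies; the closure is the inside together with its
    frontier.\<close>
  have "simple_path (c +++ reversepath d)"
    using assms by (intro simple_path_join_loop) (auto intro: arc_reversepath)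
  moreover have "path_image (c +++ reversepath d) = path_image c \<union> path_image d"
    using assms by (simp add: path_image_join)
  ultimately have *: "inside (path_image c \<union> path_image d) \<noteq> {}"
    "open (inside (path_image c \<union> path_image d))"
    "connected (inside (path_image c \<union> path_image d))"
    "frontier (inside (path_image c \<union> path_image d)) = path_image c \<union> path_image d"
    using Jordan_inside_outside[of "c +++ reversepath d"] assms by auto
  then show "closure (inside (path_image c \<union> path_image d)) =
      inside (path_image c \<union> path_image d) \<union> path_image c \<union> path_image d"
    by (metis Un_assoc closure_Un_frontier)
  show "connected (inside (path_image c \<union> path_image d))"
    "open (inside (path_image c \<union> path_image d))"
    "inside (path_image c \<union> path_image d) \<noteq> {}"
    using * by auto
qed

text \<open>The closed path \<open>c +++ reversepath d\<close> has the difference of the two winding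
  numbers as its own, and this is nonzero inside a simple closed path and zero outside. Being inside
  is thus decided by one number per arc, and three arcs can be compared pairwise.\<close>

lemma winding_number_arcs:
  fixes c d :: "real \<Rightarrow> complex"
  assumes "arc c" "pathstart c = a" "pathfinish c = b"
    and "arc d" "pathstart d = a" "pathfinish d = b"
    and "path_image c \<inter> path_image d = {a, b}"
    and z: "z \<notin> path_image c" "z \<notin> path_image d"
  shows "z \<in> inside (path_image c \<union> path_image d) \<longleftrightarrow> winding_number c z \<noteq> winding_number d z"
proof -
  let ?j = "c +++ reversepath d"
  have sp: "simple_path ?j"
    using assms by (intro simple_path_join_loop) (auto intro: arc_reversepath)
  have im: "path_image ?j = path_image c \<union> path_image d"
    using assms by (simp add: path_image_join)
  have loop: "pathfinish ?j = pathstart ?j"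
    using assms by simp
  have wn: "winding_number ?j z = winding_number c z - winding_number d z"
    using assms by (simp add: winding_number_join winding_number_reversepath arc_imp_path)
  have "winding_number ?j z \<noteq> 0" if "z \<in> inside (path_image ?j)"
    using simple_closed_path_norm_winding_number_inside[OF sp that] by auto
  moreover have "winding_number ?j z = 0" if "z \<notin> inside (path_image ?j)"
  proof -
    have "z \<in> outside (path_image ?j)"
      using that z im inside_Un_outside[of "path_image ?j"] by blast
    then show ?thesis
      using winding_number_zero_in_outside[OF simple_path_imp_path[OF sp] loop] by blast
  qed
  ultimately show ?thesis
    using wn im by auto
qed

text \<open>A connected set that meets both the inside and the outside of \<open>S\<close> has to
  meet \<open>S\<close>.\<close>

lemma connected_subset_inside:
  assumes "connected T" "T \<inter> S = {}" "T \<inter> inside S \<noteq> {}"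
  shows "T \<subseteq> inside S"
  using inside_outside_intersect_connected[OF assms(1), of S] assms inside_Un_outside[of S] by blast

text \<open>As \<open>c3\<close> does not enter it, the inside of \<open>c1\<close> and
  \<open>c2\<close> is a connected set that avoids \<open>c1\<close> and \<open>c3\<close>. Once it
  meets the inside of these two, it lies there. Passing to closures brings along \<open>c2\<close>,
  which is part of its frontier.\<close>

lemma theta_inside_aux:
  fixes c1 c2 c3 :: "real \<Rightarrow> complex"
  assumes c1: "arc c1" "pathstart c1 = a" "pathfinish c1 = b"
    and c2: "arc c2" "pathstart c2 = a" "pathfinish c2 = b"
    and c3: "arc c3" "pathstart c3 = a" "pathfinish c3 = b"
    and i12: "path_image c1 \<inter> path_image c2 = {a, b}"
    and i13: "path_image c1 \<inter> path_image c3 = {a, b}"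
    and i23: "path_image c2 \<inter> path_image c3 = {a, b}"
    and out: "path_image c3 \<inter> inside (path_image c1 \<union> path_image c2) = {}"
    and meet: "inside (path_image c1 \<union> path_image c2) \<inter> inside (path_image c1 \<union> path_image c3) \<noteq> {}"
  shows "path_image c2 - {a, b} \<subseteq> inside (path_image c1 \<union> path_image c3)"
proof -
  let ?I = "inside (path_image c1 \<union> path_image c2)" and ?J = "inside (path_image c1 \<union> path_image c3)"
  have "?I \<inter> (path_image c1 \<union> path_image c3) = {}"
    using out inside_no_overlap[of "path_image c1 \<union> path_image c2"] by blast
  then have "?I \<subseteq> ?J"
    using closure_inside_arcs[OF c1 c2 i12] meet by (intro connected_subset_inside) auto
  then have "closure ?I \<subseteq> closure ?J"
    by (rule closure_mono)
  then have "path_image c2 \<subseteq> ?J \<union> path_image c1 \<union> path_image c3"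
    unfolding closure_inside_arcs[OF c1 c2 i12] closure_inside_arcs[OF c1 c3 i13] by blast
  then show ?thesis
    using i12 i23 by blast
qed

text \<open>The winding numbers of the three closed curves around a point add up to zero, so a point
  inside one of them is inside another one.\<close>

lemma theta_inside:
  fixes c1 c2 c3 :: "real \<Rightarrow> complex"
  assumes c1: "arc c1" "pathstart c1 = a" "pathfinish c1 = b"
    and c2: "arc c2" "pathstart c2 = a" "pathfinish c2 = b"
    and c3: "arc c3" "pathstart c3 = a" "pathfinish c3 = b"
    and i12: "path_image c1 \<inter> path_image c2 = {a, b}"
    and i13: "path_image c1 \<inter> path_image c3 = {a, b}"
    and i23: "path_image c2 \<inter> path_image c3 = {a, b}"
  shows "path_image c1 - {a, b} \<subseteq> inside (path_image c2 \<union> path_image c3) \<or>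
         path_image c2 - {a, b} \<subseteq> inside (path_image c1 \<union> path_image c3) \<or>
         path_image c3 - {a, b} \<subseteq> inside (path_image c1 \<union> path_image c2)"
proof (cases "path_image c3 \<inter> inside (path_image c1 \<union> path_image c2) = {}")
  case True
  obtain z where z: "z \<in> inside (path_image c1 \<union> path_image c2)"
    using closure_inside_arcs(4)[OF c1 c2 i12] by blast
  then have nz: "z \<notin> path_image c1" "z \<notin> path_image c2" "z \<notin> path_image c3"
    using True inside_no_overlap[of "path_image c1 \<union> path_image c2"] by blast+
  then have "winding_number c1 z \<noteq> winding_number c2 z"
    using winding_number_arcs[OF c1 c2 i12] z by blast
  \<comment> \<open>A third number differs from at least one of two distinct numbers.\<close>
  then consider "winding_number c1 z \<noteq> winding_number c3 z" | "winding_number c2 z \<noteq> winding_number c3 z"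
    by fastforce
  then show ?thesis
  proof cases
    case 1
    then have "z \<in> inside (path_image c1 \<union> path_image c3)"
      using winding_number_arcs[OF c1 c3 i13] nz by blast
    then show ?thesis
      using theta_inside_aux[OF c1 c2 c3 i12 i13 i23 True] z by blast
  next
    case 2
    then have "z \<in> inside (path_image c2 \<union> path_image c3)"
      using winding_number_arcs[OF c2 c3 i23] nz by blast
    then show ?thesis
      using theta_inside_aux[OF c2 c1 c3 _ i23 i13] True z i12 by (auto simp: Un_commute Int_commute)
  qed
next
  case False
  \<comment> \<open>Without its ends \<open>c3\<close> is connected and misses the curve, so having
    entered the inside it stays there.\<close>
  have "path_image c3 - {a, b} \<subseteq> inside (path_image c1 \<union> path_image c2)"
  proof (rule connected_subset_inside)
    show "connected (path_image c3 - {a, b})"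
      using connected_simple_path_endless[OF arc_imp_simple_path[OF c3(1)]] c3 by simp
    show "(path_image c3 - {a, b}) \<inter> (path_image c1 \<union> path_image c2) = {}"
      using i13 i23 by blast
    show "(path_image c3 - {a, b}) \<inter> inside (path_image c1 \<union> path_image c2) \<noteq> {}"
      using False inside_no_overlap[of "path_image c1 \<union> path_image c2"] i12 by blast
  qed
  then show ?thesis by blast
qed

section \<open>Walks and the arcs that draw them\<close>

fun walk_edges :: "'a list \<Rightarrow> 'a set set" where
  "walk_edges (x # y # xs) = insert {x, y} (walk_edges (y # xs))"
| "walk_edges xs = {}"

lemma walk_edges_subset: "e \<in> walk_edges xs \<Longrightarrow> e \<subseteq> set xs"
  by (induction xs rule: walk_edges.induct) auto

text \<open>The first edge joins \<open>a\<close> to a vertex of \<open>xs\<close>, and the later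
  edges avoid \<open>a\<close>. This keeps two paths with common ends from sharing the edge between
  these ends.\<close>

lemma ends_notin_walk_edges:
  assumes "distinct (a # xs @ [b])" "xs \<noteq> []"
  shows "{a, b} \<notin> walk_edges (a # xs @ [b])"
  using assms walk_edges_subset[of "{a, b}" "xs @ [b]"] by (cases xs) (auto simp: doubleton_eq_iff)

lemma walk_edges_in_edges:
  "successively (adjacent G) xs \<Longrightarrow> walk_edges xs \<subseteq> edges G"
  by (induction xs rule: walk_edges.induct) (auto simp: adjacent_def)

text \<open>The arcs of the edges are joined one after another. The walk has at least two vertices,
  since a single point is not an arc.\<close>

lemma plane_embedding_walk:
  assumes emb: "plane_embedding G p g"
    and "distinct (x # y # xs)" "successively (adjacent G) (x # y # xs)"
  shows "\<exists>c. arc c \<and> pathstart c = p x \<and> pathfinish c = p (last (y # xs)) \<and>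
             path_image c = (\<Union>e\<in>walk_edges (x # y # xs). path_image (g e))"
  using assms(2,3)
proof (induction "x # y # xs" arbitrary: x y xs rule: walk_edges.induct)
  case (1 x y xs)
  have e: "{x, y} \<in> edges G"
    using 1 by (simp add: adjacent_def)
  then have g: "arc (g {x, y})" "{pathstart (g {x, y}), pathfinish (g {x, y})} = {p x, p y}"
    using emb by (auto simp: plane_embedding_def)
  \<comment> \<open>An embedding does not prescribe the direction of \<open>g {x, y}\<close>, so the
    arc is reversed if it starts at \<open>p y\<close>.\<close>
  have "\<exists>d. arc d \<and> pathstart d = p x \<and> pathfinish d = p y \<and> path_image d = path_image (g {x, y})"
  proof (cases "pathstart (g {x, y}) = p x")
    case True
    then show ?thesis using g by (metis arc_distinct_ends doubleton_eq_iff)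
  next
    case False
    then have "pathstart (g {x, y}) = p y" "pathfinish (g {x, y}) = p x"
      using g(2) by (auto simp: doubleton_eq_iff)
    then show ?thesis
      using g by (intro exI[of _ "reversepath (g {x, y})"]) (simp add: arc_reversepath)
  qed
  then obtain d where d: "arc d" "pathstart d = p x" "pathfinish d = p y"
    "path_image d = path_image (g {x, y})"
    by blast
  show ?case
  proof (cases xs)
    case Nil
    then show ?thesis using d by auto
  next
    case (Cons z zs)
    obtain c where c: "arc c" "pathstart c = p y" "pathfinish c = p (last (z # zs))"
      "path_image c = (\<Union>e\<in>walk_edges (y # z # zs). path_image (g e))"
      using 1 Cons by (auto simp: successively_Cons)
    \<comment> \<open>\<open>x\<close> does not occur again in the walk, so a later edge shares at
      most \<open>y\<close> with \<open>{x, y}\<close>.\<close>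
    have "path_image (g {x, y}) \<inter> path_image (g e) \<subseteq> {p y}" if "e \<in> walk_edges (y # z # zs)" for e
    proof -
      have "e \<subseteq> set (y # z # zs)" "e \<in> edges G"
        using walk_edges_subset[OF that] walk_edges_in_edges[of G "y # z # zs"] that 1 Cons by auto
      moreover from this have "x \<notin> e"
        using 1 Cons by auto
      moreover from this have "path_image (g {x, y}) \<inter> path_image (g e) \<subseteq> p ` ({x, y} \<inter> e)"
        using e \<open>e \<in> edges G\<close> emb unfolding plane_embedding_def by blast
      ultimately show ?thesis by auto
    qed
    then have "path_image d \<inter> path_image c \<subseteq> {pathstart c}"
      unfolding c(2,4) d(4) by blast
    then have "arc (d +++ c)"
      using c d by (intro arc_join) auto
    then show ?thesis
      using c d Cons by (intro exI[of _ "d +++ c"]) (auto simp: path_image_join)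
  qed
qed

lemma plane_embedding_walk':
  assumes "plane_embedding G p g"
    and "distinct (a # xs @ [b])" "successively (adjacent G) (a # xs @ [b])"
  obtains c where "arc c" "pathstart c = p a" "pathfinish c = p b"
    "path_image c = (\<Union>e\<in>walk_edges (a # xs @ [b]). path_image (g e))"
proof (cases xs)
  case Nil
  then show ?thesis
    using plane_embedding_walk[OF assms(1), of a b "[]"] assms that by auto
next
  case (Cons y ys)
  then show ?thesis
    using plane_embedding_walk[OF assms(1), of a y "ys @ [b]"] assms that by auto
qed

text \<open>Edges of the two paths share at most the vertices \<open>a\<close> and \<open>b\<close>.
  A common edge would have to be \<open>{a, b}\<close>, which cannot belong to a path with an inner
  vertex. So the edges are distinct, and their arcs meet only in common vertices.\<close>

lemma plane_embedding_walks_Int: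
  assumes "simple_graph G" "plane_embedding G p g"
    and ab: "a \<noteq> b" and dis: "distinct (a # b # xs @ ys)" and ne: "xs \<noteq> [] \<or> ys \<noteq> []"
    and sx: "successively (adjacent G) (a # xs @ [b])"
    and sy: "successively (adjacent G) (a # ys @ [b])"
  shows "(\<Union>e\<in>walk_edges (a # xs @ [b]). path_image (g e)) \<inter>
         (\<Union>e\<in>walk_edges (a # ys @ [b]). path_image (g e)) \<subseteq> {p a, p b}"
proof -
  have "path_image (g e) \<inter> path_image (g e') \<subseteq> {p a, p b}"
    if e: "e \<in> walk_edges (a # xs @ [b])" and e': "e' \<in> walk_edges (a # ys @ [b])" for e e'
  proof -
    have "e \<subseteq> set (a # xs @ [b])" "e' \<subseteq> set (a # ys @ [b])"
      using e e' walk_edges_subset by metis+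
    then have sub: "e \<inter> e' \<subseteq> {a, b}"
      using dis by auto
    have E: "e \<in> edges G" "e' \<in> edges G"
      using e e' walk_edges_in_edges sx sy by blast+
    have "e \<noteq> e'"
    proof
      assume "e = e'"
      moreover have "card e = 2"
        using assms(1) E by (simp add: simple_graph_def)
      ultimately have "e = {a, b}"
        using sub ab by (metis Int_absorb card_2_iff card_subset_eq finite.emptyI finite.insertI)
      then show False
        using ends_notin_walk_edges[of a xs b] ends_notin_walk_edges[of a ys b] \<open>e = e'\<close> e e' dis ne
        by auto
    qed
    then have "path_image (g e) \<inter> path_image (g e') \<subseteq> p ` (e \<inter> e')"
      using assms(2) E unfolding plane_embedding_def by blast
    then show ?thesis
      using sub by auto
  qed
  then show ?thesis by blast
qed

lemma in_path_image_walk: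
  assumes "plane_embedding G p g" "successively (adjacent G) (a # xs @ [b])" "x \<in> set (a # xs @ [b])"
  shows "p x \<in> (\<Union>e\<in>walk_edges (a # xs @ [b]). path_image (g e))"
proof -
  have "\<exists>e\<in>walk_edges zs. x \<in> e" if "x \<in> set zs" "length zs \<ge> 2" for zs
    using that
  proof (induction zs rule: walk_edges.induct)
    case (1 u v ws)
    then show ?case by (cases ws) auto
  qed auto
  from this[OF assms(3)] obtain e where e: "e \<in> walk_edges (a # xs @ [b])" "x \<in> e"
    by auto
  then have "e \<in> edges G"
    using walk_edges_in_edges assms(2) by blast
  then have "p ` e \<subseteq> path_image (g e)"
    using assms(1) unfolding plane_embedding_def by blast
  then show ?thesis
    using e by blast
qed

text \<open>\<open>v\<close> is a limit of points outside \<open>D\<close>. If the open set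
  \<open>inside S\<close> contained \<open>v\<close>, it would contain such points, but these are
  also outside the smaller set \<open>S\<close>.\<close>

lemma outer_vertex_not_inside:
  assumes "S \<subseteq> D" and "open (inside S)" and "v \<in> frontier (outside D)"
  shows "v \<notin> inside S"
proof
  assume "v \<in> inside S"
  moreover have "v \<in> closure (outside D)"
    using assms(3) by (simp add: frontier_def)
  ultimately have "inside S \<inter> outside D \<noteq> {}"
    using assms(2) open_Int_closure_eq_empty by blast
  then show False
    using outside_mono[OF assms(1)] inside_Int_outside[of S] by blast
qed

section \<open>Outerplanar graphs contain no theta graph and no \<open>K\<^sub>4\<close>\<close>

text \<open>Graphs without a subdivision of \<open>K\<^sub>2\<^sub>,\<^sub>3\<close>.\<close>

definition theta_free :: "'a graph \<Rightarrow> bool" where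
  "theta_free G \<longleftrightarrow> \<not> (\<exists>a b xs ys zs. distinct (a # b # xs @ ys @ zs) \<and>
     xs \<noteq> [] \<and> ys \<noteq> [] \<and> zs \<noteq> [] \<and> successively (adjacent G) (a # xs @ [b]) \<and>
     successively (adjacent G) (a # ys @ [b]) \<and> successively (adjacent G) (a # zs @ [b]))"

lemma adjacent_commute: "adjacent G u v \<longleftrightarrow> adjacent G v u"
  by (simp add: adjacent_def insert_commute)

text \<open>Removing only one end lets connectedness carry a point inside a curve over to the vertex
  at the other end, as \<open>no_K4\<close> requires.\<close>

lemma connected_arc_minus_start:
  assumes "arc c"
  shows "connected (path_image c - {pathstart c})"
proof -
  have "path_image c - {pathstart c} = c ` {0<..1}"
    using inj_onD[OF arc_imp_inj_on[OF assms]]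
    by (force simp: path_image_def pathstart_def less_eq_real_def)
  moreover have "continuous_on {0<..1} c"
    using arc_imp_path[OF assms] unfolding path_def by (rule continuous_on_subset) auto
  ultimately show ?thesis
    by (simp add: connected_continuous_image)
qed

lemma connected_arc_minus_finish:
  assumes "arc c"
  shows "connected (path_image c - {pathfinish c})"
  using connected_arc_minus_start[OF arc_reversepath[OF assms]] by simp

lemma simple_graph_adjacent:
  assumes "simple_graph G" "adjacent G u v"
  shows "u \<in> verts G" "v \<in> verts G" "u \<noteq> v"
proof -
  have "{u, v} \<subseteq> verts G" "card {u, v} = 2"
    using assms unfolding simple_graph_def adjacent_def by blast+
  then show "u \<in> verts G" "v \<in> verts G" "u \<noteq> v"
    by auto
qed

section \<open>A graph with a fixed outerplane embedding\<close>

locale outerplane_graph =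
  fixes G :: "'a graph" and p :: "'a \<Rightarrow> complex" and g :: "'a set \<Rightarrow> real \<Rightarrow> complex"
  assumes simple: "simple_graph G"
    and emb: "plane_embedding G p g"
    and outer: "p ` verts G \<subseteq> frontier (outside (drawing G p g))"
begin

abbreviation walk_image :: "'a list \<Rightarrow> complex set" where
  "walk_image xs \<equiv> (\<Union>e\<in>walk_edges xs. path_image (g e))"

lemma edge_images_Int:
  "\<lbrakk>e \<in> edges G; e' \<in> edges G; e \<noteq> e'\<rbrakk>
    \<Longrightarrow> path_image (g e) \<inter> path_image (g e') \<subseteq> p ` (e \<inter> e')"
  using emb by (simp add: plane_embedding_def)

lemma walk_image_subset_drawing:
  "successively (adjacent G) xs \<Longrightarrow> walk_image xs \<subseteq> drawing G p g"
  using walk_edges_in_edges by (fastforce simp: drawing_def)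

lemma adjacent_verts: "adjacent G u v \<Longrightarrow> u \<in> verts G \<and> v \<in> verts G"
  using simple_graph_adjacent[OF simple] by blast

lemma walk_arc:
  assumes "distinct (a # xs @ [b])" "successively (adjacent G) (a # xs @ [b])"
  obtains c where "arc c" "pathstart c = p a" "pathfinish c = p b" "path_image c = walk_image (a # xs @ [b])"
  using plane_embedding_walk'[OF emb assms] by blast

lemma walk_images_Int:
  assumes "distinct (a # b # xs @ ys)" and "xs \<noteq> [] \<or> ys \<noteq> []"
    and "successively (adjacent G) (a # xs @ [b])" and "successively (adjacent G) (a # ys @ [b])"
  shows "walk_image (a # xs @ [b]) \<inter> walk_image (a # ys @ [b]) = {p a, p b}"
proof
  show "walk_image (a # xs @ [b]) \<inter> walk_image (a # ys @ [b]) \<subseteq> {p a, p b}"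
    using assms by (intro plane_embedding_walks_Int[OF simple emb]) auto
  show "{p a, p b} \<subseteq> walk_image (a # xs @ [b]) \<inter> walk_image (a # ys @ [b])"
    using in_path_image_walk[OF emb, of a xs b] in_path_image_walk[OF emb, of a ys b] assms(3,4)
    by auto
qed

lemma vertex_not_inside:
  assumes "distinct (a # b # xs @ ys)" and "xs \<noteq> [] \<or> ys \<noteq> []"
    and "successively (adjacent G) (a # xs @ [b])" and "successively (adjacent G) (a # ys @ [b])"
    and "v \<in> verts G"
  shows "p v \<notin> inside (walk_image (a # xs @ [b]) \<union> walk_image (a # ys @ [b]))"
proof -
  obtain c where c: "arc c" "pathstart c = p a" "pathfinish c = p b" "path_image c = walk_image (a # xs @ [b])"
    using walk_arc[of a xs b] assms by auto
  obtain d where d: "arc d" "pathstart d = p a" "pathfinish d = p b" "path_image d = walk_image (a # ys @ [b])"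
    using walk_arc[of a ys b] assms by auto
  have "path_image c \<inter> path_image d = {p a, p b}"
    unfolding c d by (rule walk_images_Int[OF assms(1-4)])
  from closure_inside_arcs(3)[OF c(1-3) d(1-3) this]
  have "open (inside (walk_image (a # xs @ [b]) \<union> walk_image (a # ys @ [b])))"
    unfolding c d .
  moreover have "walk_image (a # xs @ [b]) \<union> walk_image (a # ys @ [b]) \<subseteq> drawing G p g"
    using walk_image_subset_drawing assms(3,4) by simp
  moreover have "p v \<in> frontier (outside (drawing G p g))"
    using outer assms(5) by blast
  ultimately show ?thesis
    using outer_vertex_not_inside by blast
qed

text \<open>By \<open>theta_inside\<close> one of the three paths runs inside the curve formed by
  the other two. A path with an inner vertex cannot, since all vertices are on the outer face, so it
  is the path through \<open>xs\<close> and this path is a single edge. Admitting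
  \<open>xs = []\<close> serves both the exclusion of theta graphs and \<open>no_K4\<close>.\<close>

lemma theta_walks:
  assumes dis: "distinct (a # b # xs @ ys @ zs)" and ne: "ys \<noteq> []" "zs \<noteq> []"
    and sx: "successively (adjacent G) (a # xs @ [b])"
    and sy: "successively (adjacent G) (a # ys @ [b])"
    and sz: "successively (adjacent G) (a # zs @ [b])"
  shows "xs = [] \<and> walk_image (a # xs @ [b]) - {p a, p b} \<subseteq>
    inside (walk_image (a # ys @ [b]) \<union> walk_image (a # zs @ [b]))"
proof -
  have not_inside: False
    if d: "distinct (a # b # us @ vs @ ws)" "us \<noteq> []" "vs \<noteq> []"
      and s: "successively (adjacent G) (a # us @ [b])" "successively (adjacent G) (a # vs @ [b])"
        "successively (adjacent G) (a # ws @ [b])"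
      and "walk_image (a # us @ [b]) - {p a, p b} \<subseteq>
        inside (walk_image (a # vs @ [b]) \<union> walk_image (a # ws @ [b]))" for us vs ws
  proof -
    obtain u us' where u: "us = u # us'"
      using d(2) by (cases us) auto
    have V: "u \<in> verts G" "a \<in> verts G" "b \<in> verts G"
      using s(1,2) adjacent_verts d(3) by (auto simp: u successively_append_iff successively_Cons)
    then have "p u \<noteq> p a" "p u \<noteq> p b"
      using emb d(1) by (auto simp: plane_embedding_def inj_on_def u)
    moreover have "p u \<in> walk_image (a # us @ [b])"
      using in_path_image_walk[OF emb s(1)] u by simp
    ultimately have "p u \<in> inside (walk_image (a # vs @ [b]) \<union> walk_image (a # ws @ [b]))"
      using that(7) by blast
    then show False
      using vertex_not_inside[OF _ _ s(2,3) V(1)] d by auto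
  qed
  obtain c1 where c1: "arc c1" "pathstart c1 = p a" "pathfinish c1 = p b" "path_image c1 = walk_image (a # xs @ [b])"
    using walk_arc[of a xs b] dis sx by auto
  obtain c2 where c2: "arc c2" "pathstart c2 = p a" "pathfinish c2 = p b" "path_image c2 = walk_image (a # ys @ [b])"
    using walk_arc[of a ys b] dis sy by auto
  obtain c3 where c3: "arc c3" "pathstart c3 = p a" "pathfinish c3 = p b" "path_image c3 = walk_image (a # zs @ [b])"
    using walk_arc[of a zs b] dis sz by auto
  have i: "path_image c1 \<inter> path_image c2 = {p a, p b}" "path_image c1 \<inter> path_image c3 = {p a, p b}"
    "path_image c2 \<inter> path_image c3 = {p a, p b}"
    unfolding c1 c2 c3 using dis ne sx sy sz by (intro walk_images_Int; auto)+
  have "\<not> path_image c2 - {p a, p b} \<subseteq> inside (path_image c1 \<union> path_image c3)"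
    using not_inside[of ys zs xs] dis ne sx sy sz unfolding c1 c2 c3 by (auto simp: Un_commute)
  moreover have "\<not> path_image c3 - {p a, p b} \<subseteq> inside (path_image c1 \<union> path_image c2)"
    using not_inside[of zs ys xs] dis ne sx sy sz unfolding c1 c2 c3 by (auto simp: Un_commute)
  ultimately have *: "path_image c1 - {p a, p b} \<subseteq> inside (path_image c2 \<union> path_image c3)"
    using theta_inside[OF c1(1-3) c2(1-3) c3(1-3) i] by blast
  moreover have "xs = []"
    using not_inside[of xs ys zs] dis ne sx sy sz * unfolding c1 c2 c3 by auto
  ultimately show ?thesis
    unfolding c1 c2 c3 by blast
qed

lemma theta_free: "theta_free G"
  unfolding theta_free_def using theta_walks by blast

lemma chord_inside:
  assumes "distinct [a, b, c, d]" and "adjacent G a b" "adjacent G a c" "adjacent G a d"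
    "adjacent G b c" "adjacent G b d"
  shows "path_image (g {a, b}) - {p a, p b} \<subseteq>
    inside (path_image (g {a, c}) \<union> path_image (g {c, b}) \<union> (path_image (g {a, d}) \<union> path_image (g {d, b})))"
  using theta_walks[of a b "[]" "[c]" "[d]"] assms by (simp add: adjacent_commute)

text \<open>Both diagonals of the 4-cycle \<open>a c b d\<close> would have to run inside it.\<close>

lemma no_K4:
  assumes dis: "distinct [a, b, c, d]" and adj: "adjacent G a b" "adjacent G a c" "adjacent G a d"
    "adjacent G b c" "adjacent G b d" "adjacent G c d"
  shows False
proof -
  let ?im = "\<lambda>x y. path_image (g {x, y})"
  let ?C = "?im a c \<union> ?im c b" and ?D = "?im a d \<union> ?im d b"
  have cd_in: "?im c d - {p c, p d} \<subseteq> inside (?C \<union> ?D)"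
    using chord_inside[of c d a b] dis adj by (auto simp: adjacent_commute insert_commute Un_ac)
  have ab_in: "?im a b - {p a, p b} \<subseteq> inside (?C \<union> ?D)"
    using chord_inside[of a b c d] dis adj by simp
  have V: "a \<in> verts G" "b \<in> verts G" "c \<in> verts G" "d \<in> verts G"
    using adj adjacent_verts by auto
  have pts: "p c \<noteq> p d" "p c \<noteq> p a" "p c \<noteq> p b" "p d \<noteq> p a" "p d \<noteq> p b" "p a \<noteq> p b"
    using emb V dis by (auto simp: plane_embedding_def inj_on_def)
  obtain r where r: "arc r" "pathstart r = p c" "pathfinish r = p d" "path_image r = ?im c d"
    using walk_arc[of c "[]" d] dis adj by auto
  obtain c1 where c1: "arc c1" "pathstart c1 = p a" "pathfinish c1 = p b" "path_image c1 = ?C"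
    using walk_arc[of a "[c]" b] dis adj by (auto simp: adjacent_commute)
  obtain c2 where c2: "arc c2" "pathstart c2 = p a" "pathfinish c2 = p b" "path_image c2 = ?D"
    using walk_arc[of a "[d]" b] dis adj by (auto simp: adjacent_commute)
  obtain c3 where c3: "arc c3" "pathstart c3 = p a" "pathfinish c3 = p b" "path_image c3 = ?im a b"
    using walk_arc[of a "[]" b] dis adj by auto
  have i12: "?C \<inter> ?D = {p a, p b}"
    using walk_images_Int[of a b "[c]" "[d]"] dis adj by (simp add: adjacent_commute)
  have i13: "?C \<inter> ?im a b = {p a, p b}"
    using walk_images_Int[of a b "[c]" "[]"] dis adj by (simp add: adjacent_commute)
  have i23: "?D \<inter> ?im a b = {p a, p b}"
    using walk_images_Int[of a b "[d]" "[]"] dis adj by (simp add: adjacent_commute)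
  have cross: "?im c d \<inter> ?im x y \<subseteq> p ` ({c, d} \<inter> {x, y})"
    if "adjacent G x y" "{x, y} \<noteq> {c, d}" for x y
    using that adj(6) by (intro edge_images_Int) (auto simp: adjacent_def)
  have icdab: "?im c d \<inter> ?im a b = {}"
    using cross[OF adj(1)] dis by (auto simp: doubleton_eq_iff)
  have icdac: "?im c d \<inter> ?im a c \<subseteq> {p c}" and icdcb: "?im c d \<inter> ?im c b \<subseteq> {p c}"
    and icdad: "?im c d \<inter> ?im a d \<subseteq> {p d}" and icddb: "?im c d \<inter> ?im d b \<subseteq> {p d}"
    using cross[of a c] cross[of c b] cross[of a d] cross[of d b] adj dis
    by (auto simp: doubleton_eq_iff adjacent_commute)
  have "?im a b \<inter> inside (?C \<union> ?D) \<noteq> {}"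
    using ab_in nonempty_simple_path_endless[OF arc_imp_simple_path[OF c3(1)]] c3 by auto
  \<comment> \<open>The arc of the edge \<open>ab\<close> cuts the inside of the 4-cycle into the
    insides of the triangles \<open>abc\<close> and \<open>abd\<close>.\<close>
  then have split: "inside (?C \<union> ?im a b) \<union> inside (?D \<union> ?im a b) \<union> (?im a b - {p a, p b})
      = inside (?C \<union> ?D)"
    using split_inside_simple_closed_curve[OF arc_imp_simple_path[OF c1(1)] c1(2,3)
      arc_imp_simple_path[OF c2(1)] c2(2,3) arc_imp_simple_path[OF c3(1)] c3(2,3) pts(6)]
      i12 i13 i23 unfolding c1(4) c2(4) c3(4) by blast
  obtain z where z: "z \<in> ?im c d" "z \<noteq> p c" "z \<noteq> p d"
    using nonempty_simple_path_endless[OF arc_imp_simple_path[OF r(1)]] r by auto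
  then consider "z \<in> inside (?C \<union> ?im a b)" | "z \<in> inside (?D \<union> ?im a b)"
    using cd_in icdab split by blast
  then show False
  proof cases
    case 1
    \<comment> \<open>The arc of \<open>cd\<close> meets the triangle \<open>abc\<close> at most in
      \<open>p c\<close>. Without this end it is connected, so it would carry \<open>p d\<close>
      into the triangle, where no vertex can be.\<close>
    have "connected (?im c d - {p c})"
      using connected_arc_minus_start[OF r(1)] unfolding r .
    moreover have "(?im c d - {p c}) \<inter> (?C \<union> ?im a b) = {}"
      using icdab icdac icdcb by blast
    ultimately have "?im c d - {p c} \<subseteq> inside (?C \<union> ?im a b)"
      using z 1 by (intro connected_subset_inside) auto
    then have "p d \<in> inside (?C \<union> ?im a b)"
      using pts(1) r pathfinish_in_path_image by force
    then show False
      using vertex_not_inside[of a b "[c]" "[]" d] dis adj V by (simp add: adjacent_commute)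
  next
    case 2
    have "connected (?im c d - {p d})"
      using connected_arc_minus_finish[OF r(1)] unfolding r .
    moreover have "(?im c d - {p d}) \<inter> (?D \<union> ?im a b) = {}"
      using icdab icdad icddb by blast
    ultimately have "?im c d - {p d} \<subseteq> inside (?D \<union> ?im a b)"
      using z 2 by (intro connected_subset_inside) auto
    then have "p c \<in> inside (?D \<union> ?im a b)"
      using pts(1) r pathstart_in_path_image by force
    then show False
      using vertex_not_inside[of a b "[d]" "[]" c] dis adj V by (simp add: adjacent_commute)
  qed
qed

end

section \<open>Multigraphs without theta graphs\<close>

lemma theta_freeD:
  assumes "theta_free G" and "distinct (a # b # xs @ ys @ zs)" "xs \<noteq> []" "ys \<noteq> []" "zs \<noteq> []"
    and "successively (adjacent G) (a # xs @ [b])" "successively (adjacent G) (a # ys @ [b])"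
      "successively (adjacent G) (a # zs @ [b])"
  shows False
  using assms unfolding theta_free_def by blast

text \<open>The multigraph with vertex set \<open>S\<close> and edge set \<open>Q\<close>, where \<open>E q\<close> are the two ends of \<open>q\<close>;
  its subdivision is a subgraph of \<open>G\<close>.\<close>

locale subdivided_multigraph =
  fixes G :: "'a graph" and S Q :: "'a set" and E :: "'a \<Rightarrow> 'a set"
  assumes fin_S: "finite S" and fin_Q: "finite Q" and disj: "S \<inter> Q = {}"
    and E_subset: "q \<in> Q \<Longrightarrow> E q \<subseteq> S" and card_E: "q \<in> Q \<Longrightarrow> card (E q) = 2"
    and E_adjacent: "q \<in> Q \<Longrightarrow> x \<in> E q \<Longrightarrow> adjacent G q x"
begin

text \<open>Paths of the multigraph, listing vertices and edges in turn and growing at the head;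
  read as vertices of \<open>G\<close> they are paths of the subdivision. Freshness is demanded
  within each kind, and the disjointness of \<open>S\<close> and \<open>Q\<close> does the
  rest.\<close>

inductive alternating :: "'a list \<Rightarrow> bool" where
  Single: "x \<in> S \<Longrightarrow> alternating [x]"
| Cons: "\<lbrakk>alternating (x # xs); q \<in> Q; E q = {y, x}; y \<notin> set (x # xs); q \<notin> set xs\<rbrakk>
    \<Longrightarrow> alternating (y # q # x # xs)"

lemma alternating_subset: "alternating xs \<Longrightarrow> set xs \<subseteq> S \<union> Q"
  by (induction rule: alternating.induct) (use E_subset in auto)

lemma alternating_hd: "alternating xs \<Longrightarrow> hd xs \<in> S"
  by (induction rule: alternating.induct) (use E_subset in auto)

lemma alternating_distinct: "alternating xs \<Longrightarrow> distinct xs"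
proof (induction rule: alternating.induct)
  case (Cons x xs q y)
  then have "y \<in> S" "x \<in> S"
    using E_subset by auto
  then show ?case
    using Cons disj by auto
qed auto

lemma alternating_walk: "alternating xs \<Longrightarrow> successively (adjacent G) xs"
proof (induction rule: alternating.induct)
  case (Cons x xs q y)
  then have "adjacent G q y" "adjacent G q x"
    using E_adjacent by auto
  then show ?case
    using Cons by (simp add: adjacent_commute)
qed auto

lemma alternating_ends:
  assumes "alternating xs" "q \<in> set xs" "q \<in> Q"
  shows "E q \<subseteq> set xs"
  using assms
proof (induction rule: alternating.induct)
  case (Cons x xs q' y)
  then have "y \<in> S"
    using E_subset by auto
  then show ?case
    using Cons disj by auto
qed (use disj in auto)

text \<open>An edge further down has both its ends behind the head, by
  \<open>alternating_ends\<close>, and the head does not occur there.\<close>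

lemma alternating_first_edge:
  assumes "alternating xs" "q \<in> set xs" "q \<in> Q" "hd xs \<in> E q"
  shows "\<exists>zs. xs = hd xs # q # zs"
  using assms
proof (cases rule: alternating.cases)
  case (Single x)
  then show ?thesis using assms disj by auto
next
  case (Cons x zs q' y)
  show ?thesis
  proof (cases "q = q'")
    case False
    have "y \<in> S"
      using Cons E_subset by auto
    then have "q \<in> set (x # zs)"
      using assms Cons False disj by auto
    then have "E q \<subseteq> set (x # zs)"
      using alternating_ends Cons assms by blast
    then show ?thesis
      using Cons assms by auto
  qed (use Cons in auto)
qed

lemma longest_alternating:
  assumes "S \<noteq> {}"
  obtains xs where "alternating xs" "\<And>ys. alternating ys \<Longrightarrow> length ys \<le> length xs"
proof -
  obtain x where "alternating [x]"
    using assms Single by blast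
  moreover have "length ys \<le> card (S \<union> Q)" if "alternating ys" for ys
    using alternating_subset[OF that] distinct_card[OF alternating_distinct[OF that]]
    by (metis card_mono fin_Q fin_S finite_UnI)
  ultimately show ?thesis
    using ex_has_greatest_nat[of alternating "[x]" length "Suc (card (S \<union> Q))"] that
    by (metis le_imp_less_Suc)
qed

text \<open>All ends of the edges at the first vertex \<open>x\<close> of a longest alternating path lie on the path.
  Two further edges at \<open>x\<close> together with the path form a theta graph.\<close>

lemma min_degree_theta:
  assumes "S \<noteq> {}" and deg: "\<And>x. x \<in> S \<Longrightarrow> card {q \<in> Q. x \<in> E q} \<ge> 3"
  shows "\<not> theta_free G"
proof
  assume tf: "theta_free G"
  obtain xs where xs: "alternating xs" and longest: "\<And>ys. alternating ys \<Longrightarrow> length ys \<le> length xs"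
    using longest_alternating[OF assms(1)] by blast
  obtain x rest where x: "xs = x # rest"
    using xs by (cases rule: alternating.cases) auto
  have xS: "x \<in> S"
    using alternating_hd[OF xs] x by simp
  have on_path: "\<exists>z. E q = {x, z} \<and> z \<noteq> x \<and> z \<in> set rest" if q: "q \<in> Q" "x \<in> E q" for q
  proof -
    obtain z where z: "E q = {z, x}" "z \<noteq> x"
      using card_E[OF q(1)] q(2) by (metis card_2_iff doubleton_eq_iff insertE singletonD)
    \<comment> \<open>Otherwise \<open>z\<close> is not on the path, nor is \<open>q\<close> by
      \<open>alternating_ends\<close>, and the path could be prolonged by \<open>q\<close> and
      \<open>z\<close>.\<close>
    have "z \<in> set rest"
    proof (rule ccontr)
      assume "z \<notin> set rest"
      moreover from this have "q \<notin> set rest"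
        using alternating_ends[OF xs _ q(1)] z x by auto
      ultimately have "alternating (z # q # x # rest)"
        using alternating.Cons[of x rest q z] xs q z x by simp
      then show False
        using longest x by fastforce
    qed
    then show ?thesis
      using z by auto
  qed
  have fin: "finite {q \<in> Q. x \<in> E q}"
    using fin_Q by simp
  obtain q0 where "q0 \<in> Q" "x \<in> E q0"
    using deg[OF xS] by (metis (no_types, lifting) card.empty empty_Collect_eq not_numeral_le_zero)
  then have "rest \<noteq> []"
    using on_path by fastforce
  obtain q1 y r where r: "rest = q1 # y # r" "q1 \<in> Q" "E q1 = {x, y}"
    using xs x \<open>rest \<noteq> []\<close> by (cases rule: alternating.cases) auto
  \<comment> \<open>Of the at least three edges at \<open>x\<close>, one is the first edge
    \<open>q1\<close> of the path, which leaves two others.\<close>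
  have "\<not> card ({q \<in> Q. x \<in> E q} - {q1}) \<le> Suc 0"
    using deg[OF xS] by (auto simp: card_Diff_singleton_if)
  then obtain e2 e3 where e: "e2 \<in> Q" "x \<in> E e2" "e3 \<in> Q" "x \<in> E e3" "e2 \<noteq> e3" "e2 \<noteq> q1" "e3 \<noteq> q1"
    unfolding card_le_Suc0_iff_eq[OF finite_Diff[OF fin]] by blast
  have off: "q \<notin> set rest" if "q \<in> Q" "x \<in> E q" "q \<noteq> q1" for q
    using alternating_first_edge[OF xs, of q] that x r by auto
  have ends: "\<exists>z. E q = {x, z} \<and> z \<noteq> x \<and> z \<in> set (y # r)" if q: "q \<in> Q" "x \<in> E q" for q
  proof -
    obtain z where z: "E q = {x, z}" "z \<noteq> x" "z \<in> set rest"
      using on_path[OF q] by blast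
    moreover have "z \<noteq> q1"
      using z(1) E_subset[OF q(1)] r disj by auto
    ultimately show ?thesis
      using r by auto
  qed
  define tip where "tip q = (THE z. E q = {x, z})" for q
  have tip: "E q = {x, tip q}" "tip q \<noteq> x" "tip q \<in> set (y # r)" if q: "q \<in> Q" "x \<in> E q" for q
  proof -
    obtain z where z: "E q = {x, z}" "z \<noteq> x" "z \<in> set (y # r)"
      using ends[OF q] by blast
    then have "tip q = z"
      unfolding tip_def by (auto simp: doubleton_eq_iff)
    then show "E q = {x, tip q}" "tip q \<noteq> x" "tip q \<in> set (y # r)"
      using z by auto
  qed
  \<comment> \<open>Along the path, \<open>z\<close> is the first tip met. Of the two edges,
    \<open>f\<close> is one that ends in \<open>z\<close>, and the tip of \<open>h\<close> is
    \<open>z\<close> or comes later; for parallel edges the tips coincide.\<close>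
  obtain us z vs where split: "y # r = us @ z # vs" "z \<in> {tip e2, tip e3}" "\<forall>u\<in>set us. u \<notin> {tip e2, tip e3}"
    using tip(3)[OF e(1,2)] split_list_first_prop[of "y # r" "\<lambda>u. u \<in> {tip e2, tip e3}"] by blast
  define f where "f = (if z = tip e2 then e2 else e3)"
  define h where "h = (if z = tip e2 then e3 else e2)"
  have f: "f \<in> Q" "x \<in> E f" "f \<noteq> q1" "f \<notin> set rest" "tip f = z"
    and h: "h \<in> Q" "x \<in> E h" "h \<noteq> q1" "h \<notin> set rest" and fh: "f \<noteq> h"
    using e off split(2) by (auto simp: f_def h_def)
  have "tip h \<in> set (z # vs)"
    using tip(3)[OF h(1,2)] split by (auto simp: h_def split: if_splits)
  then obtain bs cs where bs: "z # vs = bs @ tip h # cs"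
    by (meson split_list)
  \<comment> \<open>The stretch of the path behind \<open>z\<close> up to the tip of
    \<open>h\<close>, empty if this tip is \<open>z\<close>.\<close>
  define ds where "ds = tl (bs @ [tip h])"
  have ds: "bs @ [tip h] = z # ds" 
    using bs by (cases bs) (auto simp: ds_def)
  have full: "xs = x # q1 # us @ z # ds @ cs"
    using x r split(1) bs ds by (metis append_Cons append_assoc append_Nil)
  have dis: "distinct (x # q1 # us @ z # ds @ cs)"
    using alternating_distinct[OF xs] full by simp
  have walk: "successively (adjacent G) (x # q1 # us @ z # ds @ cs)"
    using alternating_walk[OF xs] full by simp
  have sub: "set (us @ z # ds) \<subseteq> set rest"
    using full x by auto
  have fh_x: "f \<noteq> x" "h \<noteq> x"
    using f h xS disj by auto
  have adj: "adjacent G x f" "adjacent G f z" "adjacent G x h" "adjacent G h (tip h)"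
    using E_adjacent f h tip(1)[OF f(1,2)] tip(1)[OF h(1,2)] by (auto simp: adjacent_commute)
  show False
  \<comment> \<open>From \<open>x\<close> to \<open>z\<close>: along the path, through
    \<open>f\<close>, and through \<open>h\<close> followed by the path backwards from the tip of
    \<open>h\<close>.\<close>
  proof (rule theta_freeD[OF tf, of x z "q1 # us" "[f]" "h # rev ds"])
    show "distinct (x # z # (q1 # us) @ [f] @ h # rev ds)"
      using dis sub f h fh fh_x by auto
    show "successively (adjacent G) (x # (q1 # us) @ [z])"
      using walk successively_append_iff[of "adjacent G" "x # q1 # us @ [z]" "ds @ cs"] by simp
    show "successively (adjacent G) (x # [f] @ [z])"
      using adj by simp
    have "successively (adjacent G) (z # ds)"
      using walk successively_append_iff[of "adjacent G" "x # q1 # us" "(z # ds) @ cs"]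
        successively_append_iff[of "adjacent G" "z # ds" cs] by simp
    then have "successively (adjacent G) (rev (z # ds))"
      unfolding successively_rev by (rule successively_mono) (simp add: adjacent_commute)
    moreover have "hd (rev (z # ds)) = tip h"
      unfolding ds[symmetric] by simp
    ultimately show "successively (adjacent G) (x # (h # rev ds) @ [z])"
      using adj by (simp add: successively_Cons)
  qed auto
qed

end

text \<open>By \<open>min_degree_theta\<close> some vertex has at most two edges. Deleting it with
  these edges lowers the right side by 2 and \<open>card Q\<close> by at most 2. A single vertex
  carries no edge, because every edge has two ends.\<close>

lemma subdivided_multigraph_bound:
  assumes "theta_free G" "subdivided_multigraph G S Q E" "S \<noteq> {}"
  shows "card Q + 2 \<le> 2 * card S"
  using assms(2,3)
proof (induction "card S" arbitrary: S Q)
  case 0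
  then show ?case
    by (simp add: subdivided_multigraph_def)
next
  case (Suc n)
  interpret subdivided_multigraph G S Q E by fact
  have "\<exists>x\<in>S. \<not> 3 \<le> card {q \<in> Q. x \<in> E q}"
    using min_degree_theta[OF Suc.prems(2)] assms(1) by blast
  then obtain x where x: "x \<in> S" "card {q \<in> Q. x \<in> E q} < 3"
    unfolding not_le by blast
  let ?Q = "{q \<in> Q. x \<notin> E q}"
  show ?case
  proof (cases "S = {x}")
    case True
    have "Q = {}"
    proof (rule equals0I)
      fix q assume "q \<in> Q"
      then have "card (E q) \<le> card {x}"
        using E_subset True by (intro card_mono) auto
      then show False
        using card_E[OF \<open>q \<in> Q\<close>] by simp
    qed
    then show ?thesis
      using True by simp
  next
    case False
    have "subdivided_multigraph G (S - {x}) ?Q E"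
      by unfold_locales (use fin_S fin_Q disj E_subset card_E E_adjacent in auto)
    moreover have "n = card (S - {x})" "S - {x} \<noteq> {}"
      using Suc(2) x(1) fin_S False by auto
    ultimately have "card ?Q + 2 \<le> 2 * card (S - {x})"
      using Suc.hyps(1) by blast
    moreover have "card Q = card ?Q + card {q \<in> Q. x \<in> E q}"
      using fin_Q by (subst card_Un_disjoint[symmetric]) (auto intro: arg_cong[of _ _ card])
    ultimately show ?thesis
      using x Suc(2) \<open>n = card (S - {x})\<close> by linarith
  qed
qed

section \<open>The graphs \<open>G\<^sub>k\<close> in a given graph\<close>

lemma dominating_set_image:
  assumes dom: "dominating_set K D" and bij: "bij_betw f (verts K) (verts G)"
    and adj: "\<And>x y. \<lbrakk>x \<in> verts K; y \<in> verts K; adjacent K x y\<rbrakk> \<Longrightarrow> adjacent G (f x) (f y)"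
  shows "dominating_set G (f ` D)"
  unfolding dominating_set_def
proof (intro conjI ballI)
  have D: "D \<subseteq> verts K"
    using dom by (simp add: dominating_set_def)
  then show "f ` D \<subseteq> verts G"
    using bij by (auto simp: bij_betw_def)
  fix u assume "u \<in> verts G - f ` D"
  moreover have "verts G = f ` verts K"
    using bij by (simp add: bij_betw_def)
  ultimately obtain x where x: "x \<in> verts K - D" "u = f x"
    by blast
  then obtain y where "y \<in> D" "adjacent K x y"
    using dom unfolding dominating_set_def by blast
  then show "\<exists>v\<in>f ` D. adjacent G u v"
    using adj D x by blast
qed

text \<open>Additional edges in \<open>G\<close> only help domination, so preserving adjacency is
  enough. Injectivity of \<open>f\<close> makes the exchange of one vertex commute with taking
  images.\<close>

lemma secure_dominating_set_image:
  assumes sec: "secure_dominating_set K D" and bij: "bij_betw f (verts K) (verts G)"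
    and adj: "\<And>x y. \<lbrakk>x \<in> verts K; y \<in> verts K; adjacent K x y\<rbrakk> \<Longrightarrow> adjacent G (f x) (f y)"
  shows "secure_dominating_set G (f ` D)"
  unfolding secure_dominating_set_def
proof (intro conjI ballI)
  have dom: "dominating_set K D"
    using sec by (simp add: secure_dominating_set_def)
  then have D: "D \<subseteq> verts K"
    by (simp add: dominating_set_def)
  show "dominating_set G (f ` D)"
    using dominating_set_image[OF dom bij adj] .
  fix u assume "u \<in> verts G - f ` D"
  moreover have "verts G = f ` verts K"
    using bij by (simp add: bij_betw_def)
  ultimately obtain x where x: "x \<in> verts K - D" "u = f x"
    by blast
  then obtain y where y: "y \<in> D" "adjacent K x y" "dominating_set K ((D - {y}) \<union> {x})"
    using sec unfolding secure_dominating_set_def by blast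
  have "f ` ((D - {y}) \<union> {x}) = (f ` D - {f y}) \<union> {u}"
    using x y D bij inj_on_image_set_diff[of f "verts K" D "{y}"] by (auto simp: bij_betw_def)
  moreover have "dominating_set G (f ` ((D - {y}) \<union> {x}))"
    using dominating_set_image[OF y(3) bij adj] .
  ultimately show "\<exists>v\<in>f ` D. adjacent G u v \<and> dominating_set G ((f ` D - {v}) \<union> {u})"
    using x y D adj by (intro bexI[of _ "f y"]) auto
qed

section \<open>The secure dominating set of \<open>Gk\<close>\<close>

lemma Gk_verts_cases:
  assumes "x \<in> verts (Gk k)"
  obtains "x = Center" | i where "x = Vv i" "i \<in> {1..k}"
    | i where "x = Wv (2 * i - 1)" "i \<in> {1..k}" | i where "x = Wv (2 * i)" "i \<in> {1..k}"
    | i where "x = Uv i 1" "i \<in> {1..k}" | i where "x = Uv i 2" "i \<in> {1..k}"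
proof -
  \<comment> \<open>The parity of \<open>j\<close> assigns each \<open>w\<close>-vertex to the piece
    of its neighbour \<open>Vv i\<close>.\<close>
  have "\<exists>i\<in>{1..k}. x = Wv (2 * i - 1) \<or> x = Wv (2 * i)" if "x = Wv j" "j \<in> {1..2 * k}" for j
  proof (cases "even j")
    case True
    then obtain i where "j = 2 * i" by (elim evenE)
    then show ?thesis using that by (intro bexI[of _ i]) auto
  next
    case False
    then obtain i where "j = 2 * i + 1" by (elim oddE)
    then show ?thesis using that by (intro bexI[of _ "Suc i"]) auto
  qed
  then show ?thesis
    using assms that by (auto simp: Gk_def)
qed

lemma adjacent_Gk:
  assumes "i \<in> {1..k}"
  shows "adjacent (Gk k) Center (Wv (2 * i - 1))" "adjacent (Gk k) Center (Wv (2 * i))"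
    "adjacent (Gk k) (Vv i) (Wv (2 * i - 1))" "adjacent (Gk k) (Vv i) (Wv (2 * i))"
    "adjacent (Gk k) (Vv i) (Uv i 1)" "adjacent (Gk k) (Vv i) (Uv i 2)"
    "adjacent (Gk k) (Uv i 1) (Uv i 2)"
proof -
  have "2 * i - 1 \<in> {1..2 * k}" "2 * i \<in> {1..2 * k}"
    using assms by auto
  then show "adjacent (Gk k) Center (Wv (2 * i - 1))" "adjacent (Gk k) Center (Wv (2 * i))"
    "adjacent (Gk k) (Vv i) (Wv (2 * i - 1))" "adjacent (Gk k) (Vv i) (Wv (2 * i))"
    "adjacent (Gk k) (Vv i) (Uv i 1)" "adjacent (Gk k) (Vv i) (Uv i 2)"
    "adjacent (Gk k) (Uv i 1) (Uv i 2)"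
    using assms unfolding adjacent_def Gk_def by auto
qed

lemma verts_Gk:
  "Center \<in> verts (Gk k)"
  "i \<in> {1..k} \<Longrightarrow> Vv i \<in> verts (Gk k)"
  "i \<in> {1..k} \<Longrightarrow> Wv (2 * i - 1) \<in> verts (Gk k)"
  "i \<in> {1..k} \<Longrightarrow> Wv (2 * i) \<in> verts (Gk k)"
  "i \<in> {1..k} \<Longrightarrow> Uv i 1 \<in> verts (Gk k)"
  "i \<in> {1..k} \<Longrightarrow> Uv i 2 \<in> verts (Gk k)"
proof -
  have "2 * i - 1 \<in> {1..2 * k}" if "i \<in> {1..k}"
    using that by auto
  then show "i \<in> {1..k} \<Longrightarrow> Wv (2 * i - 1) \<in> verts (Gk k)"
    unfolding Gk_def by simp
qed (auto simp: Gk_def)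

lemma dominating_Gk_I:
  assumes "T \<subseteq> verts (Gk k)"
    and "Center \<in> T \<or> (\<exists>v\<in>T. adjacent (Gk k) Center v)"
    and "\<And>i x. \<lbrakk>i \<in> {1..k}; x \<in> {Vv i, Wv (2 * i - 1), Wv (2 * i), Uv i 1, Uv i 2}\<rbrakk>
      \<Longrightarrow> x \<in> T \<or> (\<exists>v\<in>T. adjacent (Gk k) x v)"
  shows "dominating_set (Gk k) T"
  unfolding dominating_set_def
proof (intro conjI ballI)
  fix x assume x: "x \<in> verts (Gk k) - T"
  then have "x \<in> verts (Gk k)" by blast
  then show "\<exists>v\<in>T. adjacent (Gk k) x v"
    by (cases rule: Gk_verts_cases) (use assms(2,3) x in blast)+
qed (use assms in auto)

text \<open>\<open>Center\<close> defends every \<open>w\<close>-vertex: after the exchange it is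
  dominated by that vertex, and every piece still by its \<open>Vv j\<close>. \<open>Vv i\<close>
  defends \<open>Uv i 1\<close> and \<open>Uv i 2\<close>: the new vertex dominates
  \<open>Vv i\<close> and its twin, while \<open>Center\<close> dominates the two
  \<open>w\<close>-vertices of the piece.\<close>

lemma secure_dominating_set_Gk:
  assumes "k \<ge> 1"
  shows "secure_dominating_set (Gk k) (insert Center (Vv ` {1..k}))"
proof -
  let ?D = "insert Center (Vv ` {1..k})"
  note adj = adjacent_Gk adjacent_Gk[THEN adjacent_commute[THEN iffD1]]
  have sub: "?D \<subseteq> verts (Gk k)"
    using verts_Gk by auto
  have Vdom: "x \<in> {Vv i, Wv (2 * i - 1), Wv (2 * i), Uv i 1, Uv i 2} \<Longrightarrow> x = Vv i \<or> adjacent (Gk k) x (Vv i)"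
    if "i \<in> {1..k}" for i x
    using adj[OF that] by auto
  have dom: "dominating_set (Gk k) ?D"
    using sub Vdom by (intro dominating_Gk_I) blast+
  have W: "\<exists>v\<in>?D. adjacent (Gk k) x v \<and> dominating_set (Gk k) ((?D - {v}) \<union> {x})"
    if x: "x = Wv (2 * i - 1) \<or> x = Wv (2 * i)" and i: "i \<in> {1..k}" for x i
  proof (intro bexI conjI)
    show a: "adjacent (Gk k) x Center"
      using x adj[OF i] by auto
    show "dominating_set (Gk k) ((?D - {Center}) \<union> {x})"
    proof (rule dominating_Gk_I)
      show "(?D - {Center}) \<union> {x} \<subseteq> verts (Gk k)"
        using sub x verts_Gk(3,4)[OF i] by blast
      show "Center \<in> ?D - {Center} \<union> {x} \<or> (\<exists>v\<in>?D - {Center} \<union> {x}. adjacent (Gk k) Center v)"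
        using a adjacent_commute by fastforce
      show "y \<in> ?D - {Center} \<union> {x} \<or> (\<exists>v\<in>?D - {Center} \<union> {x}. adjacent (Gk k) y v)"
        if "j \<in> {1..k}" "y \<in> {Vv j, Wv (2 * j - 1), Wv (2 * j), Uv j 1, Uv j 2}" for j y
        using Vdom[OF that] that(1) by auto
    qed
  qed simp
  have U: "\<exists>v\<in>?D. adjacent (Gk k) x v \<and> dominating_set (Gk k) ((?D - {v}) \<union> {x})"
    if x: "x = Uv i 1 \<or> x = Uv i 2" and i: "i \<in> {1..k}" for x i
  proof (intro bexI conjI)
    show a: "adjacent (Gk k) x (Vv i)"
      using x adj[OF i] by auto
    show "dominating_set (Gk k) ((?D - {Vv i}) \<union> {x})"
    proof (rule dominating_Gk_I)
      show "(?D - {Vv i}) \<union> {x} \<subseteq> verts (Gk k)"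
        using sub x verts_Gk(5,6)[OF i] by blast
      show "Center \<in> ?D - {Vv i} \<union> {x} \<or> (\<exists>v\<in>?D - {Vv i} \<union> {x}. adjacent (Gk k) Center v)"
        by simp
      show "y \<in> ?D - {Vv i} \<union> {x} \<or> (\<exists>v\<in>?D - {Vv i} \<union> {x}. adjacent (Gk k) y v)"
        if j: "j \<in> {1..k}" and y: "y \<in> {Vv j, Wv (2 * j - 1), Wv (2 * j), Uv j 1, Uv j 2}" for j y
      proof (cases "j = i")
        case True
        then show ?thesis
          using y x adj[OF i] by auto
      next
        case False
        then show ?thesis
          using Vdom[OF that] j by auto
      qed
    qed
  qed (use i in simp)
  show ?thesis
    unfolding secure_dominating_set_def
  proof (intro conjI ballI)
    fix x assume x: "x \<in> verts (Gk k) - ?D"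
    then have "x \<in> verts (Gk k)" by blast
    then show "\<exists>v\<in>?D. adjacent (Gk k) x v \<and> dominating_set (Gk k) ((?D - {v}) \<union> {x})"
      by (cases rule: Gk_verts_cases) (use x W U in blast)+
  qed (fact dom)
qed

text \<open>The set is copied along the inverse isomorphism, which preserves adjacency into
  \<open>G\<close> because \<open>H\<close> is a subgraph of \<open>G\<close>.\<close>

lemma secure_dominating_set_if_spanning_Gk:
  assumes "k \<ge> 1" "spanning_subgraph H G" "isomorphic H (Gk k)"
  shows "\<exists>S. secure_dominating_set G S \<and> card S = k + 1"
proof -
  obtain f where f: "bij_betw f (verts H) (verts (Gk k))"
    "\<forall>u\<in>verts H. \<forall>v\<in>verts H. adjacent H u v \<longleftrightarrow> adjacent (Gk k) (f u) (f v)"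
    using assms(3) by (auto simp: isomorphic_def)
  let ?g = "inv_into (verts H) f" and ?D = "insert Center (Vv ` {1..k})"
  have H: "verts H = verts G" "edges H \<subseteq> edges G"
    using assms(2) by (auto simp: spanning_subgraph_def)
  have g: "bij_betw ?g (verts (Gk k)) (verts G)"
    using bij_betw_inv_into[OF f(1)] H by simp
  have "adjacent G (?g x) (?g y)" if xy: "x \<in> verts (Gk k)" "y \<in> verts (Gk k)" "adjacent (Gk k) x y" for x y
  proof -
    have "f (?g x) = x" "f (?g y) = y"
      using xy f(1) bij_betw_inv_into_right by fastforce+
    moreover have "?g x \<in> verts H" "?g y \<in> verts H"
      using xy g H by (auto simp: bij_betw_def)
    ultimately have "adjacent H (?g x) (?g y)"
      using f(2) xy(3) by auto
    then show ?thesis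
      using H by (auto simp: adjacent_def)
  qed
  then have "secure_dominating_set G (?g ` ?D)"
    by (rule secure_dominating_set_image[OF secure_dominating_set_Gk[OF assms(1)] g])
  moreover have "card (?g ` ?D) = k + 1"
  proof -
    have "?D \<subseteq> verts (Gk k)"
      using verts_Gk by auto
    then have "inj_on ?g ?D"
      using inj_on_subset[OF bij_betw_imp_inj_on[OF g]] by blast
    then have "card (?g ` ?D) = card ?D"
      by (rule card_image)
    also have "\<dots> = k + 1"
      by (subst card_insert_disjoint) (auto simp: card_image inj_on_def)
    finally show ?thesis .
  qed
  ultimately show ?thesis by blast
qed

section \<open>Recognising a spanning copy of \<open>Gk\<close>\<close>

lemma card_Gk_le: "card (verts (Gk k)) \<le> 5 * k + 1"
proof -
  have "verts (Gk k) = {Center} \<union> Vv ` {1..k} \<union> Wv ` {1..2*k} \<union> (\<lambda>i. Uv i 1) ` {1..k} \<union> (\<lambda>i. Uv i 2) ` {1..k}"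
    by (auto simp: Gk_def)
  moreover have "card (({Center} \<union> Vv ` {1..k}) \<union> Wv ` {1..2*k} \<union> (\<lambda>i. Uv i 1) ` {1..k} \<union> (\<lambda>i. Uv i 2) ` {1..k})
    \<le> (((1 + k) + 2 * k) + k) + k"
    by (intro order.trans[OF card_Un_le] add_mono) (auto intro: order.trans[OF card_image_le])
  ultimately show ?thesis
    by simp
qed

text \<open>A surjection from at most \<open>5 * k + 1\<close> vertices onto
  \<open>5 * k + 1\<close> vertices is injective, so counting replaces any check that images are
  distinct. \<open>H\<close> consists of the images of the edges.\<close>

lemma spanning_Gk_if_hom:
  assumes "simple_graph G" "card (verts G) = 5 * k + 1"
    and surj: "f ` verts (Gk k) = verts G"
    and edges: "\<And>e. e \<in> edges (Gk k) \<Longrightarrow> f ` e \<in> edges G"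
  shows "\<exists>H. spanning_subgraph H G \<and> isomorphic H (Gk k)"
proof -
  have "card (f ` verts (Gk k)) = card (verts (Gk k))"
    using card_image_le[OF finite_verts_Gk, of f k] card_Gk_le[of k] assms(2) surj by simp
  then have inj: "inj_on f (verts (Gk k))"
    using finite_verts_Gk eq_card_imp_inj_on by blast
  let ?H = "(verts G, (`) f ` edges (Gk k))"
  have adj: "adjacent ?H (f x) (f y) \<longleftrightarrow> adjacent (Gk k) x y"
    if "x \<in> verts (Gk k)" "y \<in> verts (Gk k)" for x y
  proof -
    have "{f x, f y} \<in> (`) f ` edges (Gk k) \<longleftrightarrow> {x, y} \<in> edges (Gk k)"
    proof
      assume "{f x, f y} \<in> (`) f ` edges (Gk k)"
      then obtain e where e: "f ` e = f ` {x, y}" "e \<in> edges (Gk k)"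
        by auto
      then have "e \<subseteq> verts (Gk k)"
        using simple_graph_Gk[of k] by (auto simp: simple_graph_def)
      then have "e = {x, y}"
        using inj_on_image_eq_iff[OF inj, of e "{x, y}"] e(1) that by blast
      then show "{x, y} \<in> edges (Gk k)"
        using e(2) by simp
    next
      assume "{x, y} \<in> edges (Gk k)"
      from imageI[OF this, of "(`) f"] show "{f x, f y} \<in> (`) f ` edges (Gk k)"
        by simp
    qed
    then show ?thesis
      by (simp add: adjacent_def)
  qed
  have "spanning_subgraph ?H G"
    using assms(1) edges by (auto simp: spanning_subgraph_def simple_graph_def)
  moreover have "isomorphic ?H (Gk k)"
    unfolding isomorphic_def
  proof (intro exI[of _ "inv_into (verts (Gk k)) f"] conjI ballI)
    have "bij_betw f (verts (Gk k)) (verts ?H)"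
      using inj surj by (simp add: bij_betw_def)
    then show "bij_betw (inv_into (verts (Gk k)) f) (verts ?H) (verts (Gk k))"
      by (rule bij_betw_inv_into)
    fix u v assume "u \<in> verts ?H" "v \<in> verts ?H"
    then have "u \<in> f ` verts (Gk k)" "v \<in> f ` verts (Gk k)"
      using surj by auto
    then obtain x y where "x \<in> verts (Gk k)" "y \<in> verts (Gk k)" "u = f x" "v = f y"
      by blast
    then show "adjacent ?H u v \<longleftrightarrow>
        adjacent (Gk k) (inv_into (verts (Gk k)) f u) (inv_into (verts (Gk k)) f v)"
      using adj inj by simp
  qed
  ultimately show ?thesis by blast
qed

text \<open>It suffices to find the image of \<open>G\<^sub>k\<close> as a star of \<open>k\<close> pieces, each hanging on a vertex \<open>s\<close>
  of \<open>R\<close>, with \<open>W s\<close> and \<open>U s\<close> in the roles of \<open>{w\<^sub>2\<^sub>i\<^sub>-\<^sub>1, w\<^sub>2\<^sub>i}\<close> and \<open>{u\<^sub>i\<^sup>1, u\<^sub>i\<^sup>2}\<close>.\<close>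

lemma spanning_Gk_if_star:
  fixes G :: "'a graph"
  assumes simple: "simple_graph G" and card_V: "card (verts G) = 5 * k + 1"
    and R: "finite R" "card R = k"
    and V: "verts G = insert c R \<union> (\<Union>s\<in>R. W s) \<union> (\<Union>s\<in>R. U s)"
    and W: "\<And>s. s \<in> R \<Longrightarrow> card (W s) = 2"
    and W_adj: "\<And>s w. \<lbrakk>s \<in> R; w \<in> W s\<rbrakk> \<Longrightarrow> adjacent G c w \<and> adjacent G s w"
    and U: "\<And>s. s \<in> R \<Longrightarrow> card (U s) = 2"
    and U_adj: "\<And>s u. \<lbrakk>s \<in> R; u \<in> U s\<rbrakk> \<Longrightarrow> adjacent G s u"
    and U_clique: "\<And>s u u'. \<lbrakk>s \<in> R; u \<in> U s; u' \<in> U s; u \<noteq> u'\<rbrakk> \<Longrightarrow> adjacent G u u'"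
  shows "\<exists>H. spanning_subgraph H G \<and> isomorphic H (Gk k)"
proof -
  obtain s where s: "bij_betw s {1..k} R"
    using ex_bij_betw_nat_finite_1[OF R(1)] R(2) by auto
  then have sR: "s i \<in> R" if "i \<in> {1..k}" for i
    using that by (auto simp: bij_betw_def)
  have "\<forall>i\<in>{1..k}. \<exists>a b. W (s i) = {a, b} \<and> a \<noteq> b"
    using W[OF sR] by (auto simp: card_2_iff)
  then obtain wa wb where w: "\<And>i. i \<in> {1..k} \<Longrightarrow> W (s i) = {wa i, wb i}"
    by metis
  have "\<forall>i\<in>{1..k}. \<exists>a b. U (s i) = {a, b} \<and> a \<noteq> b"
    using U[OF sR] by (auto simp: card_2_iff)
  then obtain ua ub where u: "\<And>i. i \<in> {1..k} \<Longrightarrow> U (s i) = {ua i, ub i} \<and> ua i \<noteq> ub i"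
    by metis
  \<comment> \<open>For the odd index \<open>j = 2 * i - 1\<close> the piece is
    \<open>i = Suc j div 2\<close>, for the even index \<open>j = 2 * i\<close> it is
    \<open>j div 2\<close>.\<close>
  define f where "f x = (case x of Center \<Rightarrow> c | Vv i \<Rightarrow> s i
    | Wv j \<Rightarrow> (if even j then wb (j div 2) else wa (Suc j div 2))
    | Uv i j \<Rightarrow> (if j = 1 then ua i else ub i))" for x
  have f: "f Center = c" "f (Vv i) = s i" "f (Wv (2 * i)) = wb i" "f (Uv i 1) = ua i" "f (Uv i 2) = ub i" for i
    by (auto simp: f_def)
  have f': "f (Wv (2 * i - 1)) = wa i" if "i \<in> {1..k}" for i
    using that by (auto simp: f_def)
  have sub: "f x \<in> verts G" if "x \<in> verts (Gk k)" for x
    using that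
  proof (cases rule: Gk_verts_cases)
    case 1
    then show ?thesis using f V by auto
  next
    case (2 i)
    then show ?thesis using f V sR by auto
  next
    case (3 i)
    then show ?thesis using f' V sR[of i] w[of i] by auto
  next
    case (4 i)
    then show ?thesis using f V sR[of i] w[of i] by auto
  next
    case (5 i)
    then show ?thesis using f(4) V sR[of i] u[of i] by auto
  next
    case (6 i)
    then show ?thesis using f(5) V sR[of i] u[of i] by auto
  qed
  have "y \<in> f ` verts (Gk k)" if y: "y \<in> verts G" for y
  proof (cases "y = c")
    case True
    then show ?thesis using f(1) verts_Gk(1) by blast
  next
    case False
    then obtain t where t: "t \<in> R" "y = t \<or> y \<in> W t \<or> y \<in> U t"
      using y V by auto
    then obtain i where i: "i \<in> {1..k}" "t = s i"
      using s by (auto simp: bij_betw_def)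
    then have "y \<in> {s i, wa i, wb i, ua i, ub i}"
      using t w[OF i(1)] u[OF i(1)] by auto
    then have "y \<in> f ` {Vv i, Wv (2 * i - 1), Wv (2 * i), Uv i 1, Uv i 2}"
      using f(2-5)[of i] f'[OF i(1)] by simp
    then show ?thesis
      using verts_Gk(2-6)[OF i(1)] by blast
  qed
  then have surj: "f ` verts (Gk k) = verts G"
    using sub by blast
  have edge: "f ` e \<in> edges G" if e: "e \<in> edges (Gk k)" for e
  proof -
    have C: "{c, f (Wv j)} \<in> edges G" if "j \<in> {1..2 * k}" for j
    proof -
      have "Wv j \<in> verts (Gk k)"
        using that by (auto simp: Gk_def)
      then show ?thesis
      proof (cases rule: Gk_verts_cases)
        case (3 i)
        then show ?thesis using W_adj[OF sR, of i "wa i"] w[of i] f' by (auto simp: adjacent_def)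
      next
        case (4 i)
        then show ?thesis using W_adj[OF sR, of i "wb i"] w[of i] f by (auto simp: adjacent_def)
      qed auto
    qed
    have "{s i, wa i} \<in> edges G" "{s i, wb i} \<in> edges G" "{s i, ua i} \<in> edges G" "{s i, ub i} \<in> edges G"
      "{ua i, ub i} \<in> edges G" if i: "i \<in> {1..k}" for i
      using W_adj[OF sR[OF i]] U_adj[OF sR[OF i]] U_clique[OF sR[OF i], of "ua i" "ub i"] w[OF i] u[OF i]
      by (auto simp: adjacent_def)
    then show ?thesis
      using e C f f' unfolding Gk_def by auto
  qed
  show ?thesis
    using spanning_Gk_if_hom[OF simple card_V surj edge] .
qed

section \<open>Small secure dominating sets\<close>

text \<open>Three common neighbours would be the inner vertices of three paths from \<open>a\<close>
  to \<open>b\<close>.\<close>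

lemma theta_free_common_neighbours:
  assumes "simple_graph G" "theta_free G" "a \<noteq> b" "finite T"
    and adj: "\<And>x. x \<in> T \<Longrightarrow> adjacent G x a \<and> adjacent G x b"
  shows "card T \<le> 2"
proof (rule ccontr)
  assume "\<not> card T \<le> 2"
  then have "3 \<le> card T" by simp
  then obtain U where "U \<subseteq> T" "card U = 3"
    using obtain_subset_with_card_n by metis
  then obtain x y z where xyz: "x \<in> T" "y \<in> T" "z \<in> T" "distinct [x, y, z]"
    by (auto simp: card_3_iff)
  have "a \<notin> T" "b \<notin> T"
    using adj simple_graph_adjacent(3)[OF assms(1)] by blast+
  then have "distinct (a # b # [x] @ [y] @ [z])"
    using xyz assms(3) by auto
  moreover have "successively (adjacent G) (a # [u] @ [b])" if "u \<in> T" for u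
    using adj[OF that] by (simp add: adjacent_commute)
  ultimately show False
    using theta_freeD[OF assms(2)] xyz(1-3) by blast
qed

text \<open>From here on outerplanarity enters only through the two excluded configurations.\<close>

locale small_secure_dominating_set =
  fixes G :: "'a graph" and S :: "'a set" and k :: nat
  assumes simple: "simple_graph G" and tf: "theta_free G"
    and no_K4: "\<lbrakk>distinct [a, b, c, d]; adjacent G a b; adjacent G a c; adjacent G a d;
      adjacent G b c; adjacent G b d; adjacent G c d\<rbrakk> \<Longrightarrow> False"
    and secure: "secure_dominating_set G S" and card_S: "card S = k + 1"
    and card_V: "card (verts G) = 5 * k + 1" and k: "k \<ge> 2"
begin

section \<open>Private neighbours and defenders\<close>

definition nbrs :: "'a \<Rightarrow> 'a set" where
  "nbrs u = {v \<in> S. adjacent G u v}"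

text \<open>The external private neighbours of \<open>v\<close>.\<close>

definition epn :: "'a \<Rightarrow> 'a set" where
  "epn v = {u \<in> verts G - S. nbrs u = {v}}"

definition Q :: "'a set" where
  "Q = {u \<in> verts G - S. card (nbrs u) \<ge> 2}"

text \<open>Of a legal exchange of \<open>v\<close> for \<open>u\<close> this keeps only what it
  demands of the private neighbours of \<open>v\<close>, a necessary condition.\<close>

definition defends :: "'a \<Rightarrow> 'a \<Rightarrow> bool" where
  "defends v u \<longleftrightarrow> v \<in> S \<and> adjacent G u v \<and> (\<forall>w\<in>epn v. w \<noteq> u \<longrightarrow> adjacent G w u)"

lemma S_subset: "S \<subseteq> verts G"
  using secure by (simp add: secure_dominating_set_def dominating_set_def)

lemma fin_V: "finite (verts G)"
  using simple by (simp add: simple_graph_def)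

lemma fin_S: "finite S"
  using fin_V S_subset finite_subset by blast

lemma finite_sets [simp]: "finite Q" "finite (epn v)" "finite (nbrs u)"
  using fin_V fin_S by (simp_all add: Q_def epn_def nbrs_def)

lemma adj_neq: "adjacent G u v \<Longrightarrow> u \<noteq> v"
  using simple_graph_adjacent(3)[OF simple] .

text \<open>When \<open>v\<close> moves to \<open>u\<close>, a private neighbour of \<open>v\<close>
  loses its only neighbour in \<open>S\<close>, so \<open>u\<close> has to dominate it.\<close>

lemma ex_defender:
  assumes "u \<in> verts G - S"
  shows "\<exists>v. defends v u"
proof -
  obtain v where v: "v \<in> S" "adjacent G u v" "dominating_set G ((S - {v}) \<union> {u})"
    using secure assms unfolding secure_dominating_set_def by blast
  have "adjacent G w u" if w: "w \<in> epn v" "w \<noteq> u" for w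
  proof -
    have "w \<in> verts G - ((S - {v}) \<union> {u})"
      using w by (auto simp: epn_def)
    then obtain x where x: "x \<in> (S - {v}) \<union> {u}" "adjacent G w x"
      using v(3) unfolding dominating_set_def by blast
    have "x \<notin> S - {v}"
    proof
      assume "x \<in> S - {v}"
      then have "x \<in> nbrs w" "x \<noteq> v"
        using x by (auto simp: nbrs_def)
      then show False
        using w by (simp add: epn_def)
    qed
    then show ?thesis
      using x by auto
  qed
  then show ?thesis
    using v unfolding defends_def by blast
qed

lemma epnD:
  assumes "u \<in> epn v"
  shows "u \<in> verts G" "u \<notin> S" "v \<in> S" "adjacent G u v" "nbrs u = {v}"
proof -
  show "u \<in> verts G" "u \<notin> S" and n: "nbrs u = {v}"
    using assms by (auto simp: epn_def)
  then have "v \<in> nbrs u" by simp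
  then show "v \<in> S" "adjacent G u v"
    by (auto simp: nbrs_def)
qed

text \<open>Only \<open>v\<close> can defend its private neighbour \<open>u\<close>, and then every
  other private neighbour of \<open>v\<close> is adjacent to \<open>u\<close>.\<close>

lemma epn_clique:
  assumes "u \<in> epn v" "w \<in> epn v" "u \<noteq> w"
  shows "adjacent G u w"
proof -
  obtain x where x: "defends x u"
    using ex_defender epnD[OF assms(1)] by blast
  then have "x \<in> nbrs u"
    by (simp add: defends_def nbrs_def)
  then have "x = v"
    using epnD[OF assms(1)] by simp
  then show ?thesis
    using x assms by (auto simp: defends_def adjacent_commute[of G u w])
qed

lemma epn_disjoint: "v \<noteq> w \<Longrightarrow> epn v \<inter> epn w = {}"
  by (auto simp: epn_def)

text \<open>Three private neighbours would form a \<open>K4\<close> with \<open>v\<close>.\<close>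

lemma card_epn: "card (epn v) \<le> 2"
proof (rule ccontr)
  assume "\<not> card (epn v) \<le> 2"
  then have "3 \<le> card (epn v)" by simp
  then obtain U where "U \<subseteq> epn v" "card U = 3"
    using obtain_subset_with_card_n by metis
  then obtain x y z where xyz: "x \<in> epn v" "y \<in> epn v" "z \<in> epn v" "x \<noteq> y" "x \<noteq> z" "y \<noteq> z"
    by (auto simp: card_3_iff)
  then have "adjacent G x v" "adjacent G y v" "adjacent G z v"
    using epnD by blast+
  moreover have "adjacent G x y" "adjacent G x z" "adjacent G y z"
    using xyz epn_clique by blast+
  ultimately show False
    using no_K4[of x y z v] xyz adj_neq by auto
qed

lemma QD:
  assumes "q \<in> Q"
  shows "q \<in> verts G" "q \<notin> S" "card (nbrs q) \<ge> 2"
  using assms by (auto simp: Q_def)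

lemma Q_not_epn: "q \<in> Q \<Longrightarrow> q \<notin> epn v"
  by (auto simp: Q_def epn_def)

text \<open>Two private neighbours of \<open>v\<close> would form a \<open>K4\<close> with
  \<open>v\<close> and \<open>q\<close>.\<close>

lemma card_epn_defender:
  assumes "q \<in> Q" "defends v q"
  shows "card (epn v) \<le> 1"
proof (rule ccontr)
  assume "\<not> card (epn v) \<le> 1"
  then have "\<not> card (epn v) \<le> Suc 0" by simp
  then obtain x y where xy: "x \<in> epn v" "y \<in> epn v" "x \<noteq> y"
    unfolding card_le_Suc0_iff_eq[OF finite_sets(2)] by blast
  have q: "q \<noteq> x" "q \<noteq> y" "adjacent G q v"
    using assms xy Q_not_epn by (auto simp: defends_def)
  have "adjacent G x q" "adjacent G y q"
    using assms xy q by (auto simp: defends_def)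
  moreover have "adjacent G x v" "adjacent G y v"
    using xy epnD by blast+
  moreover have "adjacent G x y"
    using xy epn_clique by blast
  ultimately show False
    using no_K4[of x y q v] xy q adj_neq by auto
qed

section \<open>Counting the vertices outside \<open>S\<close>\<close>

lemma card_Q_le: "card Q \<le> 2 * k"
proof -
  \<comment> \<open>Any two neighbours in \<open>S\<close> may serve as the ends of
    \<open>q\<close>; the multigraph then has \<open>k + 1\<close> vertices.\<close>
  have "\<forall>q\<in>Q. \<exists>A. A \<subseteq> nbrs q \<and> card A = 2"
    using QD(3) obtain_subset_with_card_n by metis
  then obtain E where E: "\<And>q. q \<in> Q \<Longrightarrow> E q \<subseteq> nbrs q \<and> card (E q) = 2"
    by metis
  have "subdivided_multigraph G S Q E"
  proof
    show "S \<inter> Q = {}"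
      using QD(2) by blast
    show "E q \<subseteq> S" "card (E q) = 2" if "q \<in> Q" for q
      using E[OF that] by (auto simp: nbrs_def)
    show "adjacent G q x" if "q \<in> Q" "x \<in> E q" for q x
      using E[OF that(1)] that(2) by (auto simp: nbrs_def)
  qed (use fin_S in auto)
  then show ?thesis
    using subdivided_multigraph_bound[OF tf] card_S by fastforce
qed

lemma not_S_cases:
  assumes "u \<in> verts G - S"
  shows "u \<in> Q \<or> (\<exists>v\<in>S. u \<in> epn v)"
proof (cases "card (nbrs u) \<ge> 2")
  case False
  obtain v where v: "v \<in> S" "adjacent G u v"
    using secure assms unfolding secure_dominating_set_def dominating_set_def by blast
  then have "nbrs u = {v}"
    using False card_le_Suc0_iff_eq[OF finite_sets(3)[of u]] by (fastforce simp: nbrs_def)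
  then show ?thesis
    using assms v by (auto simp: epn_def)
qed (use assms Q_def in auto)

text \<open>The \<open>5 * k + 1 - (k + 1)\<close> vertices outside \<open>S\<close> are dominated,
  so each of them either lies in \<open>Q\<close> or is private to exactly one vertex of
  \<open>S\<close>.\<close>

lemma card_Q: "card Q + (\<Sum>v\<in>S. card (epn v)) = 4 * k"
proof -
  have V: "verts G - S = Q \<union> (\<Union>v\<in>S. epn v)"
  proof
    show "verts G - S \<subseteq> Q \<union> (\<Union>v\<in>S. epn v)"
      using not_S_cases by auto
    show "Q \<union> (\<Union>v\<in>S. epn v) \<subseteq> verts G - S"
      by (auto simp: Q_def epn_def)
  qed
  have "card (\<Union>v\<in>S. epn v) = (\<Sum>v\<in>S. card (epn v))"
    using fin_S epn_disjoint by (intro card_UN_disjoint) auto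
  moreover have "card (Q \<union> (\<Union>v\<in>S. epn v)) = card Q + card (\<Union>v\<in>S. epn v)"
    using Q_not_epn fin_S by (intro card_Un_disjoint) auto
  moreover have "card (verts G - S) = 4 * k"
    using card_Diff_subset[OF fin_S S_subset] card_V card_S by simp
  ultimately show ?thesis
    using V by simp
qed

text \<open>By \<open>card_epn_defender\<close> all defenders of vertices of \<open>Q\<close> are in
  \<open>D\<close>; by \<open>card_epn\<close> the rest of \<open>S\<close> has exactly two private
  neighbours each.\<close>

definition D :: "'a set" where
  "D = {v \<in> S. card (epn v) \<le> 1}"

lemma fin_D: "finite D"
  using fin_S by (simp add: D_def)

text \<open>The sum measures by how much the bound \<open>card (epn v) \<le> 2\<close> fails to be tight; only the vertices
  of \<open>D\<close> contribute.\<close>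

lemma deficiency: "card Q + 2 = 2 * k + (\<Sum>v\<in>D. 2 - card (epn v))"
proof -
  have "(\<Sum>v\<in>S. card (epn v)) + (\<Sum>v\<in>S. 2 - card (epn v)) = (\<Sum>v\<in>S. 2)"
    unfolding sum.distrib[symmetric] using card_epn by (intro sum.cong) auto
  moreover have "(\<Sum>v\<in>S. 2 - card (epn v)) = (\<Sum>v\<in>D. 2 - card (epn v))"
    using fin_S card_epn by (intro sum.mono_neutral_right) (auto simp: D_def)
  ultimately show ?thesis
    using card_Q card_S by simp
qed

lemma deficiency_le: "(\<Sum>v\<in>D. 2 - card (epn v)) \<le> 2"
  using deficiency card_Q_le by linarith

text \<open>Each vertex of \<open>D\<close> contributes at least 1 to a sum that is at most
  2.\<close>

lemma card_D_le: "card D \<le> 2"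
proof -
  have "(\<Sum>v\<in>D. 1) \<le> (\<Sum>v\<in>D. 2 - card (epn v))"
    by (intro sum_mono) (auto simp: D_def)
  then show ?thesis
    using deficiency_le by simp
qed

section \<open>The defenders of \<open>Q\<close>\<close>

lemma ex_defender_D: "q \<in> Q \<Longrightarrow> \<exists>v\<in>D. defends v q"
  using ex_defender QD card_epn_defender unfolding D_def defends_def by blast

text \<open>The vertices of \<open>Q\<close> defended by \<open>v\<close> are common neighbours of
  \<open>v\<close> and its private neighbour \<open>p\<close>.\<close>

lemma card_defended:
  assumes "p \<in> epn v"
  shows "card {q \<in> Q. defends v q} \<le> 2"
proof (rule theta_free_common_neighbours[OF simple tf, of v p])
  show "v \<noteq> p"
    using epnD[OF assms] by auto
  show "adjacent G q v \<and> adjacent G q p" if "q \<in> {q \<in> Q. defends v q}" for q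
    using that assms Q_not_epn by (auto simp: defends_def adjacent_commute)
qed auto

lemma Q_cover: "Q = (\<Union>v\<in>D. {q \<in> Q. defends v q})"
  using ex_defender_D by blast

lemma other_neighbour:
  assumes "q \<in> Q" "v \<in> S"
  shows "\<exists>w\<in>S. w \<noteq> v \<and> adjacent G q w"
proof -
  have "\<not> card (nbrs q) \<le> Suc 0"
    using QD(3)[OF assms(1)] by simp
  then obtain x y where "x \<in> nbrs q" "y \<in> nbrs q" "x \<noteq> y"
    unfolding card_le_Suc0_iff_eq[OF finite_sets(3)] by blast
  then show ?thesis
    by (cases "x = v") (auto simp: nbrs_def)
qed

text \<open>The two defended vertices are joined through \<open>v\<close> and through
  \<open>p\<close>, so a further common neighbour in \<open>S\<close> would give a theta graph.
  Hence one of them is adjacent to \<open>w\<close> and the other to \<open>x\<close>.\<close>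

lemma two_defended:
  assumes S: "S = {v, w, x}" "distinct [v, w, x]" and p: "p \<in> epn v"
    and c: "card {q \<in> Q. defends v q} = 2"
  shows "\<exists>q r. q \<in> Q \<and> r \<in> Q \<and> q \<noteq> r \<and> defends v q \<and> defends v r \<and> adjacent G q w \<and> adjacent G r x"
proof -
  obtain q r where qr: "{q \<in> Q. defends v q} = {q, r}" "q \<noteq> r"
    using c by (auto simp: card_2_iff)
  then have Q: "q \<in> Q" "r \<in> Q" "defends v q" "defends v r"
    by blast+
  have no_common: False if "y \<in> S" "y \<noteq> v" "adjacent G q y" "adjacent G r y" for y
  proof (rule theta_freeD[OF tf, of q r "[v]" "[p]" "[y]"])
    show "distinct (q # r # [v] @ [p] @ [y])"
      using that qr Q QD Q_not_epn p epnD[OF p] by auto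
    show "successively (adjacent G) (q # [v] @ [r])" "successively (adjacent G) (q # [y] @ [r])"
      using Q that by (auto simp: defends_def adjacent_commute)
    show "successively (adjacent G) (q # [p] @ [r])"
      using Q p Q_not_epn by (auto simp: defends_def adjacent_commute)
  qed auto
  have "adjacent G q w \<or> adjacent G q x" "adjacent G r w \<or> adjacent G r x"
    using other_neighbour[of q v] other_neighbour[of r v] Q S by auto
  then show ?thesis
    using no_common[of w] no_common[of x] Q qr(2) S by auto
qed

text \<open>With \<open>q\<close> and \<open>r\<close> defended by \<open>v\<close>, and \<open>s\<close> by \<open>w\<close>, the paths \<open>q v r\<close>, \<open>q p r\<close> and
  \<open>q w s x r\<close> form a theta graph.\<close>

lemma no_two_private_defenders:
  assumes S: "S = {v, w, x}" "distinct [v, w, x]" and p: "p \<in> epn v" "p' \<in> epn w"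
    and c: "card {q \<in> Q. defends v q} = 2" "card {q \<in> Q. defends w q} = 2"
    and disj: "{q \<in> Q. defends v q} \<inter> {q \<in> Q. defends w q} = {}"
  shows False
proof -
  obtain q r where qr: "q \<in> Q" "r \<in> Q" "q \<noteq> r" "defends v q" "defends v r"
    "adjacent G q w" "adjacent G r x"
    using two_defended[OF S p(1) c(1)] by blast
  \<comment> \<open>With the roles of \<open>v\<close> and \<open>w\<close> exchanged; of the two
    vertices defended by \<open>w\<close>, the one adjacent to \<open>x\<close> is taken.\<close>
  have "S = {w, v, x}" "distinct [w, v, x]"
    using S by auto
  from two_defended[OF this p(2) c(2)] obtain s where s: "s \<in> Q" "defends w s" "adjacent G s x"
    by blast
  have "s \<noteq> q" "s \<noteq> r"
    using disj qr s by blast+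
  show False
  proof (rule theta_freeD[OF tf, of q r "[v]" "[p]" "[w, s, x]"])
    show "distinct (q # r # [v] @ [p] @ [w, s, x])"
      using \<open>s \<noteq> q\<close> \<open>s \<noteq> r\<close> qr s QD Q_not_epn p epnD[OF p(1)] S by auto
    show "successively (adjacent G) (q # [v] @ [r])" 
      using qr by (auto simp: defends_def adjacent_commute)
    show "successively (adjacent G) (q # [p] @ [r])"
      using qr p Q_not_epn by (auto simp: defends_def adjacent_commute)
    show "successively (adjacent G) (q # [w, s, x] @ [r])"
      using qr s by (auto simp: defends_def adjacent_commute)
  qed auto
qed

text \<open>A vertex of \<open>D\<close> without private neighbours uses up the whole deficiency 2,
  so it is alone in \<open>D\<close>. Otherwise each vertex of \<open>D\<close> contributes 1 and
  defends at most two vertices of \<open>Q\<close>, which leaves one small case for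
  \<open>no_two_private_defenders\<close>.\<close>

lemma ex_center:
  obtains c where "c \<in> S" "epn c = {}" "D = {c}"
proof (cases "\<exists>c\<in>D. epn c = {}")
  case True
  then obtain c where c: "c \<in> D" "epn c = {}"
    by blast
  have "(\<Sum>v\<in>D. 2 - card (epn v)) = 2 + (\<Sum>v\<in>D - {c}. 2 - card (epn v))"
    using c fin_D by (simp add: sum.remove)
  then have "(\<Sum>v\<in>D - {c}. 2 - card (epn v)) = 0"
    using deficiency_le by linarith
  then have "D - {c} = {}"
    using fin_D by (auto simp: D_def)
  then have "D = {c}"
    using c by blast
  then show ?thesis
    using c that D_def by blast
next
  case False
  then have D1: "card (epn v) = 1" if "v \<in> D" for v
    using that by (auto simp: D_def le_Suc_eq)
  then have "(\<Sum>v\<in>D. 2 - card (epn v)) = card D"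
    by simp
  then have Q: "card Q + 2 = 2 * k + card D"
    using deficiency by simp
  have le2: "card {q \<in> Q. defends v q} \<le> 2" if "v \<in> D" for v
    using card_defended False that by blast
  have "card Q \<le> (\<Sum>v\<in>D. card {q \<in> Q. defends v q})"
    using Q_cover card_UN_le[OF fin_D, of "\<lambda>v. {q \<in> Q. defends v q}"] by simp
  also have "\<dots> \<le> (\<Sum>v\<in>D. 2)"
    using le2 by (intro sum_mono)
  finally have "card Q \<le> 2 * card D"
    by simp
  \<comment> \<open>\<open>2 * k + card D - 2 = card Q \<le> 2 * card D\<close> gives
    \<open>2 * k - 2 \<le> card D \<le> 2\<close>, and \<open>k\<close> is at least 2.\<close>
  then have kD: "k = 2" "card D = 2" "card Q = 4"
    using Q card_D_le k by linarith+
  obtain v w where D: "D = {v, w}" "v \<noteq> w"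
    using kD(2) by (auto simp: card_2_iff)
  then have "card (S - {v, w}) = 1"
    using card_S kD fin_S by (subst card_Diff_subset) (auto simp: D_def)
  then obtain x where "S - {v, w} = {x}"
    by (auto simp: card_1_singleton_iff)
  then have S: "S = {v, w, x}" "distinct [v, w, x]"
    using D by (auto simp: D_def)
  obtain p p' where p: "p \<in> epn v" "p' \<in> epn w"
    using False D by blast
  let ?A = "{q \<in> Q. defends v q}" and ?B = "{q \<in> Q. defends w q}"
  have "card (?A \<union> ?B) = 4"
    using Q_cover D kD(3) by simp
  moreover have "card ?A \<le> 2" "card ?B \<le> 2"
    using le2 D by auto
  moreover have "card (?A \<union> ?B) + card (?A \<inter> ?B) = card ?A + card ?B"
    using card_Un_Int[of ?A ?B] by simp
  \<comment> \<open>Two sets of size at most 2 with a union of size 4 have size 2 and are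
    disjoint.\<close>
  ultimately have c: "card ?A = 2" "card ?B = 2" "card (?A \<inter> ?B) = 0"
    by linarith+
  have "?A \<inter> ?B = {}"
    using c(3) by (subst (asm) card_0_eq) auto
  then show ?thesis
    using no_two_private_defenders[OF S p c(1,2)] by blast
qed

text \<open>Since \<open>D = {c}\<close>, every vertex of \<open>Q\<close> is defended by
  \<open>c\<close>, and the deficiency 2 gives \<open>card Q = 2 * k\<close>. \<open>h\<close>
  selects a second neighbour in \<open>S\<close>. A fibre of \<open>h\<close> consists of common
  neighbours of \<open>c\<close> and \<open>v\<close>, hence has at most two elements; the
  \<open>k\<close> fibres cover \<open>Q\<close>, so each has exactly two.\<close>

lemma star_structure:
  obtains c h where "c \<in> S" "epn c = {}" "\<And>v. v \<in> S - {c} \<Longrightarrow> card (epn v) = 2"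
    "\<And>q. q \<in> Q \<Longrightarrow> adjacent G q c"
    "\<And>q. q \<in> Q \<Longrightarrow> h q \<in> S - {c} \<and> adjacent G q (h q)"
    "\<And>v. v \<in> S - {c} \<Longrightarrow> card {q \<in> Q. h q = v} = 2"
proof -
  obtain c where c: "c \<in> S" "epn c = {}" "D = {c}"
    using ex_center by blast
  have epn2: "card (epn v) = 2" if "v \<in> S - {c}" for v
    using that c card_epn[of v] by (auto simp: D_def)
  have adj: "adjacent G q c" if "q \<in> Q" for q
    using ex_defender_D[OF that] c by (auto simp: defends_def)
  have "\<forall>q\<in>Q. \<exists>w. w \<in> S - {c} \<and> adjacent G q w"
    using other_neighbour c by blast
  then obtain h where h: "\<And>q. q \<in> Q \<Longrightarrow> h q \<in> S - {c} \<and> adjacent G q (h q)"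
    by metis
  have cQ: "card Q = 2 * k"
    using deficiency c by simp
  have fib: "card {q \<in> Q. h q = v} \<le> 2" if "v \<in> S - {c}" for v
    using that adj h by (intro theta_free_common_neighbours[OF simple tf, of c v]) auto
  have "Q = (\<Union>v\<in>S - {c}. {q \<in> Q. h q = v})"
    using h by blast
  moreover have "card (\<Union>v\<in>S - {c}. {q \<in> Q. h q = v}) = (\<Sum>v\<in>S - {c}. card {q \<in> Q. h q = v})"
    using fin_S by (intro card_UN_disjoint) auto
  ultimately have sum: "(\<Sum>v\<in>S - {c}. card {q \<in> Q. h q = v}) = (\<Sum>v\<in>S - {c}. 2)"
    using cQ card_S c by simp
  have "card {q \<in> Q. h q = v} = 2" if "v \<in> S - {c}" for v
    using sum_mono_inv[OF sum fib that] fin_S by simp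
  then show ?thesis
    using that c epn2 adj h by blast
qed

text \<open>The fibres of \<open>h\<close> supply the pairs of \<open>w\<close>-vertices and the
  private neighbours the pairs of \<open>u\<close>-vertices, with \<open>c\<close> as the
  centre.\<close>

lemma ex_spanning_Gk: "\<exists>H. spanning_subgraph H G \<and> isomorphic H (Gk k)"
proof -
  obtain c h where c: "c \<in> S" "epn c = {}" and U: "\<And>v. v \<in> S - {c} \<Longrightarrow> card (epn v) = 2"
    and adj: "\<And>q. q \<in> Q \<Longrightarrow> adjacent G q c"
    and h: "\<And>q. q \<in> Q \<Longrightarrow> h q \<in> S - {c} \<and> adjacent G q (h q)"
    and W: "\<And>v. v \<in> S - {c} \<Longrightarrow> card {q \<in> Q. h q = v} = 2"
    using star_structure by blast
  show ?thesis
  proof (rule spanning_Gk_if_star[OF simple card_V, of "S - {c}" c "\<lambda>v. {q \<in> Q. h q = v}" epn])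
    show "finite (S - {c})" "card (S - {c}) = k"
      using fin_S card_S c by auto
    show "verts G = insert c (S - {c}) \<union> (\<Union>s\<in>S - {c}. {q \<in> Q. h q = s}) \<union> (\<Union>s\<in>S - {c}. epn s)"
    proof
      have "u \<in> insert c (S - {c}) \<union> (\<Union>s\<in>S - {c}. {q \<in> Q. h q = s}) \<union> (\<Union>s\<in>S - {c}. epn s)"
        if u: "u \<in> verts G - S" for u
        using not_S_cases[OF u]
      proof
        assume "u \<in> Q"
        then show ?thesis using h[of u] by blast
      next
        assume "\<exists>v\<in>S. u \<in> epn v"
        then show ?thesis using c by blast
      qed
      then show "verts G \<subseteq> insert c (S - {c}) \<union> (\<Union>s\<in>S - {c}. {q \<in> Q. h q = s}) \<union> (\<Union>s\<in>S - {c}. epn s)"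
        by blast
      show "insert c (S - {c}) \<union> (\<Union>s\<in>S - {c}. {q \<in> Q. h q = s}) \<union> (\<Union>s\<in>S - {c}. epn s) \<subseteq> verts G"
        using S_subset c(1) by (auto simp: Q_def epn_def)
    qed
    show "adjacent G c w \<and> adjacent G s w" if "s \<in> S - {c}" "w \<in> {q \<in> Q. h q = s}" for s w
      using that adj[of w] h[of w] adjacent_commute[of G w] by auto
    show "adjacent G s u" if "s \<in> S - {c}" "u \<in> epn s" for s u
      using epnD(4)[OF that(2)] by (simp add: adjacent_commute)
  qed (use U W epn_clique in auto)
qed

end

theorem theorem5:
  fixes G :: "'a graph" and k :: nat
  assumes "k \<ge> 2"
    and "simple_graph G"
    and "outerplanar G"
    and "card (verts G) = 5 * k + 1"
  shows "(\<exists>S. secure_dominating_set G S \<and> card S = k + 1) \<longleftrightarrow>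
         (\<exists>H. spanning_subgraph H G \<and> isomorphic H (Gk k))"
proof
  assume "\<exists>S. secure_dominating_set G S \<and> card S = k + 1"
  then obtain S where S: "secure_dominating_set G S" "card S = k + 1"
    by blast
  obtain p g where "plane_embedding G p g" "p ` verts G \<subseteq> frontier (outside (drawing G p g))"
    using assms(3) unfolding outerplanar_def by blast
  then interpret outerplane: outerplane_graph G p g
    by unfold_locales (use assms(2) in auto)
  interpret small: small_secure_dominating_set G S k
    by unfold_locales (fact assms S outerplane.theta_free outerplane.no_K4)+
  show "\<exists>H. spanning_subgraph H G \<and> isomorphic H (Gk k)"
    using small.ex_spanning_Gk .
next
  assume "\<exists>H. spanning_subgraph H G \<and> isomorphic H (Gk k)"
  then obtain H where "spanning_subgraph H G" "isomorphic H (Gk k)"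
    by blast
  then show "\<exists>S. secure_dominating_set G S \<and> card S = k + 1"
    using assms(1) by (intro secure_dominating_set_if_spanning_Gk) auto
qed

end
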